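(* Let $H: L^2(0,1)\to\ell^2$, $[Hx]_j=\int_0^1 x(t)\,t^{j-1}\,dt$ ($j=1,2,\ldots$); let $D:\ell^2\to\ell^2$, $[Dy]_j=y_j/j$ ($j=1,2,\ldots$); and let $C^*: L^2(0,1)\to L^2(0,1)$, $[C^*x](t)=\int_t^1\frac{x(s)}{s}\,ds$ ($0\le t\le 1$). For the compact operator $T=H\,C^*=D\,H: L^2(0,1)\to\ell^2$ there exists a constant $c_0>0$ such that $$\frac{c_0}{i}\exp(-2i)\le\sigma_i(T)\qquad (i=1,2,\ldots).$$
   Context: $L^2(0,1)$ and $\ell^2$ are real Hilbert spaces; $H$, $D$, $C^*$ are bounded linear operators, and $D\,H=H\,C^*$. For a compact operator $T$, $\sigma_1(T)\ge\sigma_2(T)\ge\ldots$ denote its singular values in decreasing order (counted with multiplicity). *)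

theory Defs
  imports "HOL-Analysis.Analysis"
begin

section \<open>The real Hilbert space \<open>L\<^sup>2(0,1)\<close>\<close>

abbreviation unit_measure :: "real measure" where
  "unit_measure \<equiv> lebesgue_on {0<..<1}"

definition square_integrable :: "(real \<Rightarrow> real) \<Rightarrow> bool" where
  "square_integrable f \<longleftrightarrow>
     f \<in> borel_measurable unit_measure \<and> integrable unit_measure (\<lambda>t. (f t)\<^sup>2)"

definition L2_rel :: "(real \<Rightarrow> real) \<Rightarrow> (real \<Rightarrow> real) \<Rightarrow> bool" where
  "L2_rel f g \<longleftrightarrow>
     square_integrable f \<and> square_integrable g \<and> (AE t in unit_measure. f t = g t)"

lemma square_integrable_measurable:
  "square_integrable f \<Longrightarrow> f \<in> borel_measurable unit_measure"
  by (simp add: square_integrable_def)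

lemma abs_mult_le_squares: "\<bar>a * b\<bar> \<le> a\<^sup>2 + b\<^sup>2" for a b :: real
proof -
  have "2 * \<bar>a * b\<bar> \<le> a\<^sup>2 + b\<^sup>2"
    using sum_squares_bound[of "\<bar>a\<bar>" "\<bar>b\<bar>"] by (simp add: abs_mult)
  then show ?thesis by linarith
qed

lemma square_integrable_mult:
  assumes "square_integrable f" "square_integrable g"
  shows "integrable unit_measure (\<lambda>t. f t * g t)"
proof (rule Bochner_Integration.integrable_bound)
  show "integrable unit_measure (\<lambda>t. (f t)\<^sup>2 + (g t)\<^sup>2)"
    using assms by (auto simp: square_integrable_def)
  show "(\<lambda>t. f t * g t) \<in> borel_measurable unit_measure"
    using assms by (auto simp: square_integrable_def)
  show "AE t in unit_measure. norm (f t * g t) \<le> norm ((f t)\<^sup>2 + (g t)\<^sup>2)"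
    using abs_mult_le_squares by simp
qed

lemma square_integrable_add:
  assumes "square_integrable f" "square_integrable g"
  shows "square_integrable (\<lambda>t. f t + g t)"
  using assms square_integrable_mult[OF assms]
  by (auto simp: square_integrable_def power2_sum mult.assoc)

lemma square_integrable_cmult:
  "square_integrable f \<Longrightarrow> square_integrable (\<lambda>t. c * f t)"
  by (auto simp: square_integrable_def power_mult_distrib)

lemma square_integrable_zero: "square_integrable (\<lambda>_. 0)"
  by (simp add: square_integrable_def)

lemma square_integrable_uminus: "square_integrable f \<Longrightarrow> square_integrable (\<lambda>t. - f t)"
  by (auto simp: square_integrable_def)

lemma square_integrable_diff:
  assumes "square_integrable f" "square_integrable g"
  shows "square_integrable (\<lambda>t. f t - g t)"
  using square_integrable_add[OF assms(1) square_integrable_uminus[OF assms(2)]] by simp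

quotient_type L2 = "real \<Rightarrow> real" / partial: L2_rel
proof (rule part_equivpI)
  show "\<exists>f. L2_rel f f"
    using square_integrable_zero by (auto simp: L2_rel_def)
  show "symp L2_rel"
    by (rule sympI) (auto simp: L2_rel_def)
  show "transp L2_rel"
    by (rule transpI) (auto simp: L2_rel_def)
qed

instantiation L2 :: real_vector
begin

lift_definition zero_L2 :: L2 is "\<lambda>_. 0"
  by (simp add: L2_rel_def square_integrable_zero)

lift_definition plus_L2 :: "L2 \<Rightarrow> L2 \<Rightarrow> L2" is "\<lambda>f g t. f t + g t"
  by (auto simp: L2_rel_def square_integrable_add)

lift_definition minus_L2 :: "L2 \<Rightarrow> L2 \<Rightarrow> L2" is "\<lambda>f g t. f t - g t"
  by (auto simp: L2_rel_def square_integrable_diff)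

lift_definition uminus_L2 :: "L2 \<Rightarrow> L2" is "\<lambda>f t. - f t"
  by (auto simp: L2_rel_def square_integrable_uminus)

lift_definition scaleR_L2 :: "real \<Rightarrow> L2 \<Rightarrow> L2" is "\<lambda>c f t. c * f t"
  by (auto simp: L2_rel_def square_integrable_cmult)

instance
  by standard
    (transfer; auto simp: L2_rel_def algebra_simps square_integrable_add square_integrable_zero
      square_integrable_diff square_integrable_uminus square_integrable_cmult)+

end

instantiation L2 :: real_inner
begin

lift_definition inner_L2 :: "L2 \<Rightarrow> L2 \<Rightarrow> real" is "\<lambda>f g. LINT t|unit_measure. f t * g t"
  by (rule Bochner_Integration.integral_cong_AE) (auto simp: L2_rel_def square_integrable_def)

definition norm_L2_def: "norm (x :: L2) = sqrt (inner x x)"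
definition sgn_L2_def: "sgn (x :: L2) = x /\<^sub>R norm x"
definition dist_L2_def: "dist (x :: L2) y = norm (x - y)"
definition uniformity_L2_def:
  "(uniformity :: (L2 \<times> L2) filter) = (INF e\<in>{0<..}. principal {(x, y). dist x y < e})"
definition open_L2_def:
  "open (U :: L2 set) \<longleftrightarrow> (\<forall>x\<in>U. eventually (\<lambda>(x', y). x' = x \<longrightarrow> y \<in> U) uniformity)"

instance
proof
  fix x y z :: L2 and r :: real
  show "dist x y = norm (x - y)" by (rule dist_L2_def)
  show "sgn x = x /\<^sub>R norm x" by (rule sgn_L2_def)
  show "uniformity = (INF e\<in>{0<..}. principal {(x, y :: L2). dist x y < e})"
    by (rule uniformity_L2_def)
  show "open U \<longleftrightarrow> (\<forall>x\<in>U. \<forall>\<^sub>F (x', y) in uniformity. x' = x \<longrightarrow> y \<in> U)" for U :: "L2 set"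
    by (rule open_L2_def)
  show "inner x y = inner y x"
    by transfer (simp add: mult.commute)
  show "inner (x + y) z = inner x z + inner y z"
    by transfer (simp add: L2_rel_def distrib_right square_integrable_mult)
  show "inner (r *\<^sub>R x) y = r * inner x y"
    by transfer (simp add: mult.assoc)
  show "0 \<le> inner x x"
    by transfer simp
  show "inner x x = 0 \<longleftrightarrow> x = 0"
  proof transfer
    fix f assume "L2_rel f f"
    then have f: "square_integrable f" by (simp add: L2_rel_def)
    then have "(LINT t|unit_measure. f t * f t) = 0 \<longleftrightarrow> (AE t in unit_measure. f t * f t = 0)"
      by (intro integral_nonneg_eq_0_iff_AE) (auto intro: square_integrable_mult)
    then show "(LINT t|unit_measure. f t * f t) = 0 \<longleftrightarrow> L2_rel f (\<lambda>_. 0)"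
      using f by (simp add: L2_rel_def square_integrable_zero)
  qed
  show "norm x = sqrt (inner x x)" by (rule norm_L2_def)
qed

end


section \<open>The real Hilbert space \<open>\<ell>\<^sup>2\<close>\<close>

text \<open>Sequences are indexed from \<open>0\<close>: the entry written \<open>y\<^sub>j\<close> with \<open>j = 1, 2, \<dots>\<close> is
  \<open>ell2_nth y (j - 1)\<close>.\<close>

typedef ell2 = "{a :: nat \<Rightarrow> real. summable (\<lambda>j. (a j)\<^sup>2)}"
  morphisms ell2_nth Abs_ell2
  by (rule exI[of _ "\<lambda>_. 0"]) simp

setup_lifting type_definition_ell2

lemma summable_mult_square:
  fixes a b :: "nat \<Rightarrow> real"
  assumes "summable (\<lambda>j. (a j)\<^sup>2)" "summable (\<lambda>j. (b j)\<^sup>2)"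
  shows "summable (\<lambda>j. a j * b j)"
proof (rule summable_comparison_test')
  show "summable (\<lambda>j. (a j)\<^sup>2 + (b j)\<^sup>2)" by (intro summable_add assms)
  show "norm (a j * b j) \<le> (a j)\<^sup>2 + (b j)\<^sup>2" for j
    using abs_mult_le_squares by simp
qed

lemma summable_add_square:
  fixes a b :: "nat \<Rightarrow> real"
  assumes "summable (\<lambda>j. (a j)\<^sup>2)" "summable (\<lambda>j. (b j)\<^sup>2)"
  shows "summable (\<lambda>j. (a j + b j)\<^sup>2)"
  unfolding power2_sum mult.assoc
  by (intro summable_add assms summable_mult summable_mult_square)

lemma summable_cmult_square:
  fixes a :: "nat \<Rightarrow> real"
  assumes "summable (\<lambda>j. (a j)\<^sup>2)"
  shows "summable (\<lambda>j. (c * a j)\<^sup>2)"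
  unfolding power_mult_distrib by (intro summable_mult assms)

instantiation ell2 :: real_vector
begin

lift_definition zero_ell2 :: ell2 is "\<lambda>_. 0" by simp

lift_definition plus_ell2 :: "ell2 \<Rightarrow> ell2 \<Rightarrow> ell2" is "\<lambda>a b j. a j + b j"
  by (rule summable_add_square)

lift_definition minus_ell2 :: "ell2 \<Rightarrow> ell2 \<Rightarrow> ell2" is "\<lambda>a b j. a j - b j"
  using summable_add_square summable_cmult_square[of _ "-1"] by fastforce

lift_definition uminus_ell2 :: "ell2 \<Rightarrow> ell2" is "\<lambda>a j. - a j" by simp

lift_definition scaleR_ell2 :: "real \<Rightarrow> ell2 \<Rightarrow> ell2" is "\<lambda>c a j. c * a j"
  by (rule summable_cmult_square)

instance
  by standard (transfer; auto simp: algebra_simps)+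

end

instantiation ell2 :: real_inner
begin

lift_definition inner_ell2 :: "ell2 \<Rightarrow> ell2 \<Rightarrow> real" is "\<lambda>a b. \<Sum>j. a j * b j" .

definition norm_ell2_def: "norm (x :: ell2) = sqrt (inner x x)"
definition sgn_ell2_def: "sgn (x :: ell2) = x /\<^sub>R norm x"
definition dist_ell2_def: "dist (x :: ell2) y = norm (x - y)"
definition uniformity_ell2_def:
  "(uniformity :: (ell2 \<times> ell2) filter) = (INF e\<in>{0<..}. principal {(x, y). dist x y < e})"
definition open_ell2_def:
  "open (U :: ell2 set) \<longleftrightarrow> (\<forall>x\<in>U. eventually (\<lambda>(x', y). x' = x \<longrightarrow> y \<in> U) uniformity)"

instance
proof
  fix x y z :: ell2 and r :: real
  show "dist x y = norm (x - y)" by (rule dist_ell2_def)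
  show "sgn x = x /\<^sub>R norm x" by (rule sgn_ell2_def)
  show "uniformity = (INF e\<in>{0<..}. principal {(x, y :: ell2). dist x y < e})"
    by (rule uniformity_ell2_def)
  show "open U \<longleftrightarrow> (\<forall>x\<in>U. \<forall>\<^sub>F (x', y) in uniformity. x' = x \<longrightarrow> y \<in> U)" for U :: "ell2 set"
    by (rule open_ell2_def)
  show "inner x y = inner y x"
    by transfer (simp add: mult.commute)
  show "inner (x + y) z = inner x z + inner y z"
    by transfer (simp add: distrib_right suminf_add summable_mult_square)
  show "inner (r *\<^sub>R x) y = r * inner x y"
    by transfer (simp add: mult.assoc suminf_mult summable_mult_square)
  show "0 \<le> inner x x"
    by transfer (simp add: suminf_nonneg summable_mult_square)
  show "inner x x = 0 \<longleftrightarrow> x = 0"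
    by transfer (simp add: suminf_eq_zero_iff summable_mult_square fun_eq_iff)
  show "norm x = sqrt (inner x x)" by (rule norm_ell2_def)
qed

end


section \<open>Estimates for moments and tail integrals\<close>

lemma id_measurable_unit [measurable]: "(\<lambda>t. t) \<in> borel_measurable unit_measure"
  by (rule measurable_restrict_space1) (simp add: measurable_completion)

interpretation unit: finite_measure unit_measure
  by (rule finite_measure_lebesgue_on) (simp add: bounded_set_imp_lmeasurable)

interpretation unit_pair: pair_sigma_finite unit_measure unit_measure ..

lemma square_integrable_bounded:
  assumes "f \<in> borel_measurable unit_measure" "\<And>t. t \<in> {0<..<1} \<Longrightarrow> \<bar>f t\<bar> \<le> B"
  shows "square_integrable f"
  unfolding square_integrable_def
proof
  show "integrable unit_measure (\<lambda>t. (f t)\<^sup>2)"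
  proof (rule unit.integrable_const_bound)
    show "AE t in unit_measure. norm ((f t)\<^sup>2) \<le> B\<^sup>2"
    proof (rule AE_I2)
      fix t assume "t \<in> space unit_measure"
      then have "\<bar>f t\<bar> \<le> B" using assms(2) by simp
      then have "\<bar>f t\<bar>\<^sup>2 \<le> B\<^sup>2" by (intro power_mono) auto
      then show "norm ((f t)\<^sup>2) \<le> B\<^sup>2" by simp
    qed
  qed (use assms(1) in measurable)
qed (rule assms(1))

lemma square_integrable_abs:
  "square_integrable f \<Longrightarrow> square_integrable (\<lambda>t. \<bar>f t\<bar>)"
  by (auto simp: square_integrable_def)

lemma square_integrable_power: "square_integrable (\<lambda>t. t ^ n)"
  by (rule square_integrable_bounded[of _ 1]) (auto intro!: power_le_one)

lemma square_integrable_inverse: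
  "t > 0 \<Longrightarrow> square_integrable (\<lambda>s. indicator {t..1} s / s)"
  by (rule square_integrable_bounded[of _ "1 / t"]) (auto simp: indicator_def field_simps)

lemma nn_integral_square:
  assumes "square_integrable f"
  shows "(\<integral>\<^sup>+t. ennreal ((f t)\<^sup>2) \<partial>unit_measure) = ennreal (LINT t|unit_measure. (f t)\<^sup>2)"
  using assms by (intro nn_integral_eq_integral) (auto simp: square_integrable_def)

lemma ennreal_abs_integral_le:
  fixes f :: "real \<Rightarrow> real"
  shows "ennreal \<bar>LINT t|M. f t\<bar> \<le> (\<integral>\<^sup>+t. ennreal \<bar>f t\<bar> \<partial>M)"
proof (cases "integrable M f")
  case True
  then show ?thesis using integral_norm_bound_ennreal[OF True] by simp
qed (simp add: not_integrable_integral_eq)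

lemma nn_integral_unit:
  assumes "(f has_integral I) S" "S \<subseteq> {0..1}" "\<And>t. t \<in> S \<Longrightarrow> 0 \<le> f t"
  shows "(\<integral>\<^sup>+t. ennreal (f t) * indicator S t \<partial>unit_measure) = ennreal I"
proof -
  have "(\<integral>\<^sup>+t. ennreal (f t) * indicator S t \<partial>unit_measure) =
      (\<integral>\<^sup>+t. ennreal (f t) * indicator S t * indicator {0<..<1} t \<partial>lborel)"
    by (subst nn_integral_restrict_space) (simp_all add: nn_integral_completion)
  also have "\<dots> = (\<integral>\<^sup>+t. ennreal (f t) * indicator S t \<partial>lborel)"
  proof (rule nn_integral_cong_AE)
    have "AE t in lborel. t \<noteq> (0::real)" "AE t in lborel. t \<noteq> (1::real)"
      by (rule AE_lborel_singleton)+
    then show "AE t in lborel. ennreal (f t) * indicator S t * indicator {0<..<1} t =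
        ennreal (f t) * indicator S t"
      by eventually_elim (use assms(2) in \<open>auto simp: indicator_def\<close>)
  qed
  also have "\<dots> = ennreal I"
    using assms by (intro nn_integral_has_integral_lebesgue') auto
  finally show ?thesis .
qed

lemma nn_integral_powr_head:
  assumes "0 < s" "s < 1" "a > -1"
  shows "(\<integral>\<^sup>+t. ennreal (t powr a) * indicator {0..s} t \<partial>unit_measure) = ennreal (s powr (a + 1) / (a + 1))"
  by (rule nn_integral_unit) (use assms has_integral_powr_from_0[of a s] in auto)

lemma nn_integral_powr_tail:
  assumes "0 < t" "t < 1"
  shows "(\<integral>\<^sup>+s. ennreal (s powr (-3/2)) * indicator {t..1} s \<partial>unit_measure) \<le> ennreal (2 * t powr (-1/2))"
proof -
  have "((\<lambda>s. s powr (-3/2)) has_integral (- 2 * 1 powr (-1/2) - (- 2 * t powr (-1/2)))) {t..1}"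
    by (rule fundamental_theorem_of_calculus)
       (use assms in \<open>auto intro!: derivative_eq_intros simp flip: has_real_derivative_iff_has_vector_derivative\<close>)
  then have "(\<integral>\<^sup>+s. ennreal (s powr (-3/2)) * indicator {t..1} s \<partial>unit_measure)
      = ennreal (- 2 * 1 powr (-1/2) - (- 2 * t powr (-1/2)))"
    by (rule nn_integral_unit) (use assms in auto)
  also have "\<dots> \<le> ennreal (2 * t powr (-1/2))"
    by (rule ennreal_leI) simp
  finally show ?thesis .
qed

lemma powr_combine: "0 < s \<Longrightarrow> (s powr a) ^ 2 = s powr (2 * a)" for s :: real
  by (simp add: powr_power mult.commute)

lemma Hardy_inequality:
  assumes [measurable]: "x \<in> borel_measurable unit_measure"
  shows "(\<integral>\<^sup>+t. (\<integral>\<^sup>+s. ennreal (\<bar>x s\<bar> / s) * indicator {t..1} s \<partial>unit_measure)\<^sup>2 \<partial>unit_measure)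
       \<le> 4 * (\<integral>\<^sup>+s. ennreal ((x s)\<^sup>2) \<partial>unit_measure)"
proof -
  let ?U = unit_measure
  define k where "k t s = (indicator {t..1} s :: ennreal)" for t s :: real
  have [measurable]: "case_prod k \<in> borel_measurable (?U \<Otimes>\<^sub>M ?U)"
  proof -
    have [measurable]: "fst \<in> borel_measurable (?U \<Otimes>\<^sub>M ?U)" "snd \<in> borel_measurable (?U \<Otimes>\<^sub>M ?U)"
      by (auto intro: measurable_compose[OF measurable_fst id_measurable_unit]
          measurable_compose[OF measurable_snd id_measurable_unit])
    have "case_prod k = (\<lambda>p. if fst p \<le> snd p \<and> snd p \<le> 1 then 1 else 0)"
      by (auto simp: k_def indicator_def fun_eq_iff)
    then show ?thesis by simp
  qed
  have [measurable]: "k t \<in> borel_measurable ?U" for t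
    unfolding k_def by measurable
  have k2: "k t s ^ 2 = k t s" for t s
    by (simp add: k_def indicator_def)
  have "(\<integral>\<^sup>+t. (\<integral>\<^sup>+s. ennreal (\<bar>x s\<bar> / s) * k t s \<partial>?U)\<^sup>2 \<partial>?U) \<le>
     (\<integral>\<^sup>+t. (\<integral>\<^sup>+s. ennreal (2 * t powr (-1/2)) * (ennreal ((x s)\<^sup>2 * s powr (-1/2)) * k t s) \<partial>?U) \<partial>?U)"
  proof (rule nn_integral_mono)
    fix t assume "t \<in> space ?U"
    then have t: "0 < t" "t < 1" by auto
    have "(\<integral>\<^sup>+s. ennreal (\<bar>x s\<bar> / s) * k t s \<partial>?U) =
      (\<integral>\<^sup>+s. (ennreal (\<bar>x s\<bar> * s powr (-1/4)) * k t s) * (ennreal (s powr (-3/4)) * k t s) \<partial>?U)"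
    proof (rule nn_integral_cong)
      fix s assume "s \<in> space ?U"
      then have "\<bar>x s\<bar> / s = (\<bar>x s\<bar> * s powr (-1/4)) * s powr (-3/4)"
        by (simp add: mult.assoc powr_minus_divide flip: powr_add)
      then show "ennreal (\<bar>x s\<bar> / s) * k t s =
          (ennreal (\<bar>x s\<bar> * s powr (-1/4)) * k t s) * (ennreal (s powr (-3/4)) * k t s)"
        by (simp add: k_def indicator_def ennreal_mult)
    qed
    then have "(\<integral>\<^sup>+s. ennreal (\<bar>x s\<bar> / s) * k t s \<partial>?U)\<^sup>2 \<le>
      (\<integral>\<^sup>+s. (ennreal (\<bar>x s\<bar> * s powr (-1/4)) * k t s)\<^sup>2 \<partial>?U) * (\<integral>\<^sup>+s. (ennreal (s powr (-3/4)) * k t s)\<^sup>2 \<partial>?U)"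
      using Cauchy_Schwarz_nn_integral[of "\<lambda>s. ennreal (\<bar>x s\<bar> * s powr (-1/4)) * k t s" ?U
         "\<lambda>s. ennreal (s powr (-3/4)) * k t s"] by simp
    also have "(\<integral>\<^sup>+s. (ennreal (\<bar>x s\<bar> * s powr (-1/4)) * k t s)\<^sup>2 \<partial>?U) =
       (\<integral>\<^sup>+s. ennreal ((x s)\<^sup>2 * s powr (-1/2)) * k t s \<partial>?U)"
      by (rule nn_integral_cong) (simp add: power_mult_distrib k2 ennreal_power powr_combine)
    also have "(\<integral>\<^sup>+s. (ennreal (s powr (-3/4)) * k t s)\<^sup>2 \<partial>?U) =
       (\<integral>\<^sup>+s. ennreal (s powr (-3/2)) * indicator {t..1} s \<partial>?U)"
      unfolding k_def[symmetric]
      by (rule nn_integral_cong) (simp add: power_mult_distrib k2 ennreal_power powr_combine)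
    also have "(\<integral>\<^sup>+s. ennreal ((x s)\<^sup>2 * s powr (-1/2)) * k t s \<partial>?U) *
         (\<integral>\<^sup>+s. ennreal (s powr (-3/2)) * indicator {t..1} s \<partial>?U) \<le>
       (\<integral>\<^sup>+s. ennreal ((x s)\<^sup>2 * s powr (-1/2)) * k t s \<partial>?U) * ennreal (2 * t powr (-1/2))"
      by (rule mult_left_mono[OF nn_integral_powr_tail[OF t]]) simp
    finally show "(\<integral>\<^sup>+s. ennreal (\<bar>x s\<bar> / s) * k t s \<partial>?U)\<^sup>2 \<le>
        (\<integral>\<^sup>+s. ennreal (2 * t powr (-1/2)) * (ennreal ((x s)\<^sup>2 * s powr (-1/2)) * k t s) \<partial>?U)"
      by (simp add: nn_integral_cmult mult.commute)
  qed
  also have "\<dots> = (\<integral>\<^sup>+s. (\<integral>\<^sup>+t. ennreal (2 * t powr (-1/2)) * (ennreal ((x s)\<^sup>2 * s powr (-1/2)) * k t s) \<partial>?U) \<partial>?U)"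
    by (rule unit_pair.Fubini') measurable
  also have "\<dots> = (\<integral>\<^sup>+s. 4 * ennreal ((x s)\<^sup>2) \<partial>?U)"
  proof (rule nn_integral_cong)
    fix s assume "s \<in> space ?U"
    then have s: "0 < s" "s < 1" by auto
    have "(\<integral>\<^sup>+t. ennreal (2 * t powr (-1/2)) * (ennreal ((x s)\<^sup>2 * s powr (-1/2)) * k t s) \<partial>?U)
      = (\<integral>\<^sup>+t. ennreal (2 * ((x s)\<^sup>2 * s powr (-1/2))) * (ennreal (t powr (-1/2)) * indicator {0..s} t) \<partial>?U)"
      by (rule nn_integral_cong) (use s in \<open>auto simp: k_def indicator_def ennreal_mult[symmetric]\<close>)
    also have "\<dots> = ennreal (2 * ((x s)\<^sup>2 * s powr (-1/2))) * ennreal (2 * s powr (1/2))"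
      using nn_integral_powr_head[OF s, of "-1/2"] by (simp add: nn_integral_cmult mult.commute[of _ 2])
    also have "\<dots> = ennreal (4 * ((x s)\<^sup>2 * (s powr (-1/2) * s powr (1/2))))"
      by (subst ennreal_mult[symmetric]) (auto simp: mult_ac)
    also have "\<dots> = ennreal (4 * (x s)\<^sup>2)"
      using s by (simp flip: powr_add)
    finally show "(\<integral>\<^sup>+t. ennreal (2 * t powr (-1/2)) * (ennreal ((x s)\<^sup>2 * s powr (-1/2)) * k t s) \<partial>?U)
      = 4 * ennreal ((x s)\<^sup>2)"
      by (simp add: ennreal_mult)
  qed
  also have "\<dots> = 4 * (\<integral>\<^sup>+s. ennreal ((x s)\<^sup>2) \<partial>?U)"
    by (rule nn_integral_cmult) measurable
  finally show ?thesis unfolding k_def .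
qed

lemma integrable_L2_power:
  "square_integrable x \<Longrightarrow> integrable unit_measure (\<lambda>t. x t * t ^ n)"
  by (intro square_integrable_mult square_integrable_power)

lemma integrable_L2_tail:
  assumes "square_integrable x" "0 < t"
  shows "integrable unit_measure (\<lambda>s. indicator {t..1} s * (x s / s))"
  using square_integrable_mult[OF assms(1) square_integrable_inverse[OF assms(2)]]
  by (simp add: mult_ac)

definition central_coeff :: "nat \<Rightarrow> real" where
  "central_coeff n = (\<Prod>i<n. (real i + 1/2) / (real i + 1))"

lemma central_coeff_nonneg: "0 \<le> central_coeff n"
  unfolding central_coeff_def by (intro prod_nonneg) auto

lemma central_coeff_gbinomial: "central_coeff n = ((-1/2) gchoose n) * (-1) ^ n"
proof (induction n)
  case (Suc n)
  have "((-1/2 :: real) gchoose Suc n) = ((-1/2) gchoose n) * (-1/2 - real n) / (real n + 1)"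
    using gbinomial_absorb_comp[of "-1/2 :: real" n] gbinomial_absorption'[of "Suc n" "-1/2::real"]
      Suc_times_gbinomial[of n "-1/2 - 1 :: real"]
    by (simp add: field_simps gbinomial_mult_1)
  moreover have "central_coeff (Suc n) = central_coeff n * ((real n + 1/2) / (real n + 1))"
    by (simp add: central_coeff_def)
  ultimately show ?case
    by (simp only: Suc power_Suc) (simp add: divide_simps, simp add: algebra_simps)
qed (simp add: central_coeff_def)

lemma sum_central_coeff_le:
  assumes "0 < t" "t < 1"
  shows "(\<Sum>j<n. central_coeff j * t ^ j) \<le> (1 - t) powr (-1/2)"
proof -
  have "(\<lambda>j. ((-1/2) gchoose j) * (- t) ^ j) sums (1 + (- t)) powr (-1/2)"
    by (rule gen_binomial_real) (use assms in auto)
  moreover have "((-1/2) gchoose j) * (- t) ^ j = central_coeff j * t ^ j" for j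
    by (simp add: central_coeff_gbinomial power_minus[of t])
  ultimately have s: "(\<lambda>j. central_coeff j * t ^ j) sums (1 - t) powr (-1/2)"
    by simp
  show ?thesis
    using sum_le_suminf[OF sums_summable[OF s], of "{..<n}"] sums_unique[OF s]
    by (simp add: central_coeff_nonneg assms less_imp_le)
qed

lemma Beta_half_le: "Beta (real j + 1) (1/2) \<le> 4 * central_coeff j"
proof -
  have "Beta (real j + 1) (1/2) \<le> 4 * ((2 * real j + 1) / (2 * real j + 2)) * central_coeff j"
  proof (induction j)
    case 0
    have "Beta 1 (1/2::real) = 2"
    proof -
      have "(1/2 :: real) \<notin> \<int>\<^sub>\<le>\<^sub>0"
        using nonpos_Ints_nonpos[of "1/2 :: real"] by auto
      from Gamma_plus1[OF this] have "Gamma (1/2) = 2 * Gamma (3/2 :: real)"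
        by simp
      moreover have "Gamma (3/2 :: real) \<noteq> 0"
        using Gamma_real_pos[of "3/2"] by linarith
      ultimately show ?thesis
        by (simp add: Beta_altdef rGamma_inverse_Gamma)
    qed
    then show ?case by (simp add: central_coeff_def)
  next
    case (Suc j)
    have "real j + 1 \<notin> \<int>\<^sub>\<le>\<^sub>0" by (auto elim!: nonpos_Ints_cases)
    from Beta_plus1_left[OF this, of "1/2"]
    have "Beta (real (Suc j) + 1) (1/2) = (real j + 1) / (real j + 3/2) * Beta (real j + 1) (1/2)"
      by (simp add: field_simps)
    also have "\<dots> \<le> (real j + 1) / (real j + 3/2) * (4 * ((2 * real j + 1) / (2 * real j + 2)) * central_coeff j)"
      by (intro mult_left_mono Suc) auto
    also have "\<dots> = 4 * ((2 * real j + 2) / (2 * real j + 3)) * ((real j + 1/2) / (real j + 1) * central_coeff j)"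
      by (simp add: divide_simps) (simp add: algebra_simps)
    also have "\<dots> \<le> 4 * ((2 * real (Suc j) + 1) / (2 * real (Suc j) + 2)) * ((real j + 1/2) / (real j + 1) * central_coeff j)"
      by (intro mult_right_mono mult_left_mono mult_nonneg_nonneg central_coeff_nonneg)
         (simp_all add: divide_simps, simp add: algebra_simps)
    also have "(real j + 1/2) / (real j + 1) * central_coeff j = central_coeff (Suc j)"
      by (simp add: central_coeff_def)
    finally show ?case .
  qed
  also have "\<dots> \<le> 4 * 1 * central_coeff j"
    by (intro mult_right_mono mult_left_mono central_coeff_nonneg) auto
  finally show ?thesis by simp
qed

lemma nn_integral_Beta_half:
  "(\<integral>\<^sup>+t. ennreal (t ^ j * (1 - t) powr (-1/2)) \<partial>unit_measure) \<le> ennreal (4 * central_coeff j)"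
proof -
  have "(\<integral>\<^sup>+t. ennreal (t ^ j * (1 - t) powr (-1/2)) \<partial>unit_measure)
     = (\<integral>\<^sup>+t. ennreal (t powr (real j + 1 - 1) * (1 - t) powr (1/2 - 1)) * indicator {0..1} t \<partial>unit_measure)"
    by (rule nn_integral_cong) (simp add: powr_realpow)
  also have "\<dots> = ennreal (Beta (real j + 1) (1/2))"
    by (rule nn_integral_unit[OF has_integral_Beta_real]) auto
  also have "\<dots> \<le> ennreal (4 * central_coeff j)"
    by (intro ennreal_leI Beta_half_le)
  finally show ?thesis .
qed

lemma Hilbert_inequality:
  assumes [measurable]: "x \<in> borel_measurable unit_measure"
  shows "(\<Sum>j<n. (\<integral>\<^sup>+t. ennreal (\<bar>x t\<bar> * t ^ j) \<partial>unit_measure)\<^sup>2)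
       \<le> 4 * (\<integral>\<^sup>+t. ennreal ((x t)\<^sup>2) \<partial>unit_measure)"
proof -
  let ?U = unit_measure
  have "(\<integral>\<^sup>+t. ennreal (\<bar>x t\<bar> * t ^ j) \<partial>?U)\<^sup>2 \<le>
      (\<integral>\<^sup>+t. ennreal ((x t)\<^sup>2 * (1 - t) powr (1/2)) * ennreal (4 * (central_coeff j * t ^ j)) \<partial>?U)" for j
  proof -
    define f where "f t = ennreal (\<bar>x t\<bar> * sqrt (t ^ j) * (1 - t) powr (1/4))" for t
    define g where "g t = ennreal (sqrt (t ^ j) * (1 - t) powr (-1/4))" for t
    have [measurable]: "f \<in> borel_measurable ?U" "g \<in> borel_measurable ?U"
      unfolding f_def g_def by measurable
    have "(\<integral>\<^sup>+t. ennreal (\<bar>x t\<bar> * t ^ j) \<partial>?U) = (\<integral>\<^sup>+t. f t * g t \<partial>?U)"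
    proof (rule nn_integral_cong)
      fix t assume "t \<in> space ?U"
      then have t: "0 < t" "t < 1" by auto
      have "f t * g t = ennreal (\<bar>x t\<bar> * (sqrt (t ^ j) * sqrt (t ^ j)) * ((1 - t) powr (1/4) * (1 - t) powr (-1/4)))"
        unfolding f_def g_def using t by (simp flip: ennreal_mult add: mult_ac)
      also have "\<dots> = ennreal (\<bar>x t\<bar> * t ^ j)"
        using t by (simp flip: powr_add)
      finally show "ennreal (\<bar>x t\<bar> * t ^ j) = f t * g t" by simp
    qed
    then have "(\<integral>\<^sup>+t. ennreal (\<bar>x t\<bar> * t ^ j) \<partial>?U)\<^sup>2 \<le> (\<integral>\<^sup>+t. (f t)\<^sup>2 \<partial>?U) * (\<integral>\<^sup>+t. (g t)\<^sup>2 \<partial>?U)"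
      using Cauchy_Schwarz_nn_integral[of f ?U g] by simp
    also have "(\<integral>\<^sup>+t. (f t)\<^sup>2 \<partial>?U) = (\<integral>\<^sup>+t. ennreal ((x t)\<^sup>2 * (1 - t) powr (1/2) * t ^ j) \<partial>?U)"
      by (rule nn_integral_cong) (simp add: f_def ennreal_power power_mult_distrib powr_combine mult_ac)
    also have "(\<integral>\<^sup>+t. (g t)\<^sup>2 \<partial>?U) = (\<integral>\<^sup>+t. ennreal (t ^ j * (1 - t) powr (-1/2)) \<partial>?U)"
      by (rule nn_integral_cong) (simp add: g_def ennreal_power power_mult_distrib powr_combine mult_ac)
    also have "(\<integral>\<^sup>+t. ennreal ((x t)\<^sup>2 * (1 - t) powr (1/2) * t ^ j) \<partial>?U) *
          (\<integral>\<^sup>+t. ennreal (t ^ j * (1 - t) powr (-1/2)) \<partial>?U)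
        \<le> (\<integral>\<^sup>+t. ennreal ((x t)\<^sup>2 * (1 - t) powr (1/2) * t ^ j) \<partial>?U) * ennreal (4 * central_coeff j)"
      by (rule mult_left_mono[OF nn_integral_Beta_half]) simp
    also have "\<dots> = (\<integral>\<^sup>+t. ennreal ((x t)\<^sup>2 * (1 - t) powr (1/2) * t ^ j) * ennreal (4 * central_coeff j) \<partial>?U)"
      by (rule nn_integral_multc[symmetric]) measurable
    also have "\<dots> = (\<integral>\<^sup>+t. ennreal ((x t)\<^sup>2 * (1 - t) powr (1/2)) * ennreal (4 * (central_coeff j * t ^ j)) \<partial>?U)"
      by (rule nn_integral_cong) (simp flip: ennreal_mult add: central_coeff_nonneg mult_ac)
    finally show ?thesis .
  qed
  then have "(\<Sum>j<n. (\<integral>\<^sup>+t. ennreal (\<bar>x t\<bar> * t ^ j) \<partial>?U)\<^sup>2) \<le>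
     (\<Sum>j<n. \<integral>\<^sup>+t. ennreal ((x t)\<^sup>2 * (1 - t) powr (1/2)) * ennreal (4 * (central_coeff j * t ^ j)) \<partial>?U)"
    by (intro sum_mono)
  also have "\<dots> = (\<integral>\<^sup>+t. (\<Sum>j<n. ennreal ((x t)\<^sup>2 * (1 - t) powr (1/2)) * ennreal (4 * (central_coeff j * t ^ j))) \<partial>?U)"
    by (rule nn_integral_sum[symmetric]) measurable
  also have "\<dots> \<le> (\<integral>\<^sup>+t. 4 * ennreal ((x t)\<^sup>2) \<partial>?U)"
  proof (rule nn_integral_mono)
    fix t assume "t \<in> space ?U"
    then have t: "0 < t" "t < 1" by auto
    have "(\<Sum>j<n. ennreal ((x t)\<^sup>2 * (1 - t) powr (1/2)) * ennreal (4 * (central_coeff j * t ^ j)))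
       = ennreal ((x t)\<^sup>2 * (1 - t) powr (1/2) * (4 * (\<Sum>j<n. central_coeff j * t ^ j)))"
      using t by (simp flip: ennreal_mult add: central_coeff_nonneg sum_distrib_left sum_nonneg)
    also have "\<dots> \<le> ennreal ((x t)\<^sup>2 * (1 - t) powr (1/2) * (4 * (1 - t) powr (-1/2)))"
      by (intro ennreal_leI mult_left_mono sum_central_coeff_le t) auto
    also have "(x t)\<^sup>2 * (1 - t) powr (1/2) * (4 * (1 - t) powr (-1/2)) = 4 * (x t)\<^sup>2 * ((1 - t) powr (1/2) * (1 - t) powr (-1/2))"
      by simp
    also have "\<dots> = 4 * (x t)\<^sup>2"
      using t by (simp flip: powr_add)
    finally show "(\<Sum>j<n. ennreal ((x t)\<^sup>2 * (1 - t) powr (1/2)) * ennreal (4 * (central_coeff j * t ^ j)))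
       \<le> 4 * ennreal ((x t)\<^sup>2)"
      by (simp add: ennreal_mult)
  qed
  also have "\<dots> = 4 * (\<integral>\<^sup>+t. ennreal ((x t)\<^sup>2) \<partial>?U)"
    by (rule nn_integral_cmult) measurable
  finally show ?thesis .
qed

lemma moments_bound:
  assumes "square_integrable x"
  shows "(\<Sum>j<n. (LINT t|unit_measure. x t * t ^ j)\<^sup>2) \<le> 4 * (LINT t|unit_measure. (x t)\<^sup>2)"
proof -
  have "ennreal (\<Sum>j<n. (LINT t|unit_measure. x t * t ^ j)\<^sup>2)
      = (\<Sum>j<n. (ennreal \<bar>LINT t|unit_measure. x t * t ^ j\<bar>)\<^sup>2)"
    by (simp add: ennreal_power sum_ennreal)
  also have "\<dots> \<le> (\<Sum>j<n. (\<integral>\<^sup>+t. ennreal (\<bar>x t\<bar> * t ^ j) \<partial>unit_measure)\<^sup>2)"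
  proof (intro sum_mono power_mono)
    fix j
    have "(\<integral>\<^sup>+t. ennreal \<bar>x t * t ^ j\<bar> \<partial>unit_measure) = (\<integral>\<^sup>+t. ennreal (\<bar>x t\<bar> * t ^ j) \<partial>unit_measure)"
      by (rule nn_integral_cong) (simp add: abs_mult)
    then show "ennreal \<bar>LINT t|unit_measure. x t * t ^ j\<bar> \<le> (\<integral>\<^sup>+t. ennreal (\<bar>x t\<bar> * t ^ j) \<partial>unit_measure)"
      using ennreal_abs_integral_le[of unit_measure "\<lambda>t. x t * t ^ j"] by simp
  qed simp
  also have "\<dots> \<le> 4 * (\<integral>\<^sup>+t. ennreal ((x t)\<^sup>2) \<partial>unit_measure)"
    by (intro Hilbert_inequality square_integrable_measurable assms)
  also have "\<dots> = ennreal (4 * (LINT t|unit_measure. (x t)\<^sup>2))"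
    by (simp add: nn_integral_square[OF assms] ennreal_mult)
  finally show ?thesis by (simp add: ennreal_le_iff)
qed

lemma summable_moments:
  assumes "square_integrable x"
  shows "summable (\<lambda>j. (LINT t|unit_measure. x t * t ^ j)\<^sup>2)"
  using moments_bound[OF assms] by (intro summableI_nonneg_bounded) auto

lemma tail_integral_measurable [measurable]:
  assumes [measurable]: "x \<in> borel_measurable unit_measure"
  shows "(\<lambda>t. LINT s:{t..1}|unit_measure. x s / s) \<in> borel_measurable unit_measure"
proof -
  let ?U = unit_measure
  have [measurable]: "fst \<in> borel_measurable (?U \<Otimes>\<^sub>M ?U)" "snd \<in> borel_measurable (?U \<Otimes>\<^sub>M ?U)"
    by (auto intro: measurable_compose[OF measurable_fst id_measurable_unit]
        measurable_compose[OF measurable_snd id_measurable_unit])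
  have "(\<lambda>t. LINT s|?U. (if t \<le> s \<and> s \<le> 1 then x s / s else 0)) \<in> borel_measurable ?U"
    by (rule unit.borel_measurable_lebesgue_integral) (simp add: split_beta')
  also have "(\<lambda>t. LINT s|?U. (if t \<le> s \<and> s \<le> 1 then x s / s else 0)) = (\<lambda>t. LINT s:{t..1}|?U. x s / s)"
    unfolding set_lebesgue_integral_def
    by (intro ext Bochner_Integration.integral_cong) (auto simp: indicator_def)
  finally show ?thesis .
qed

lemma tail_integral_bound:
  assumes "square_integrable x"
  shows "(\<integral>\<^sup>+t. ennreal ((LINT s:{t..1}|unit_measure. x s / s)\<^sup>2) \<partial>unit_measure)
     \<le> ennreal (4 * (LINT t|unit_measure. (x t)\<^sup>2))"
proof -
  let ?U = unit_measure
  have "(\<integral>\<^sup>+t. ennreal ((LINT s:{t..1}|?U. x s / s)\<^sup>2) \<partial>?U) \<le>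
     (\<integral>\<^sup>+t. (\<integral>\<^sup>+s. ennreal (\<bar>x s\<bar> / s) * indicator {t..1} s \<partial>?U)\<^sup>2 \<partial>?U)"
  proof (rule nn_integral_mono)
    fix t assume "t \<in> space ?U"
    have "ennreal \<bar>LINT s:{t..1}|?U. x s / s\<bar> \<le> (\<integral>\<^sup>+s. ennreal \<bar>indicator {t..1} s *\<^sub>R (x s / s)\<bar> \<partial>?U)"
      unfolding set_lebesgue_integral_def by (rule ennreal_abs_integral_le)
    also have "\<dots> = (\<integral>\<^sup>+s. ennreal (\<bar>x s\<bar> / s) * indicator {t..1} s \<partial>?U)"
      by (rule nn_integral_cong) (auto simp: indicator_def)
    finally have "(ennreal \<bar>LINT s:{t..1}|?U. x s / s\<bar>)\<^sup>2 \<le> (\<integral>\<^sup>+s. ennreal (\<bar>x s\<bar> / s) * indicator {t..1} s \<partial>?U)\<^sup>2"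
      by (rule power_mono) simp
    then show "ennreal ((LINT s:{t..1}|?U. x s / s)\<^sup>2) \<le> (\<integral>\<^sup>+s. ennreal (\<bar>x s\<bar> / s) * indicator {t..1} s \<partial>?U)\<^sup>2"
      by (simp add: ennreal_power)
  qed
  also have "\<dots> \<le> 4 * (\<integral>\<^sup>+s. ennreal ((x s)\<^sup>2) \<partial>?U)"
    by (intro Hardy_inequality square_integrable_measurable assms)
  also have "\<dots> = ennreal (4 * (LINT t|unit_measure. (x t)\<^sup>2))"
    by (simp add: nn_integral_square[OF assms] ennreal_mult)
  finally show ?thesis .
qed

lemma square_integrable_tail_integral:
  assumes "square_integrable x"
  shows "square_integrable (\<lambda>t. LINT s:{t..1}|unit_measure. x s / s)"
  unfolding square_integrable_def
proof
  have [measurable]: "x \<in> borel_measurable unit_measure"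
    by (rule square_integrable_measurable[OF assms])
  show "(\<lambda>t. LINT s:{t..1}|unit_measure. x s / s) \<in> borel_measurable unit_measure"
    by measurable
  then have [measurable]: "(\<lambda>t. (LINT s:{t..1}|unit_measure. x s / s)\<^sup>2) \<in> borel_measurable unit_measure"
    by measurable
  show "integrable unit_measure (\<lambda>t. (LINT s:{t..1}|unit_measure. x s / s)\<^sup>2)"
    using tail_integral_bound[OF assms]
    by (intro integrableI_bounded) (auto simp: less_top[symmetric] top_unique)
qed


section \<open>The operators \<open>H\<close>, \<open>D\<close> and \<open>C\<^sup>*\<close>\<close>

lemma moment_cong:
  "L2_rel x y \<Longrightarrow> (LINT t|unit_measure. x t * t ^ j) = (LINT t|unit_measure. y t * t ^ j)"
  by (rule Bochner_Integration.integral_cong_AE)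
     (auto simp: L2_rel_def dest: square_integrable_measurable)

lemma tail_integral_cong:
  assumes "L2_rel x y"
  shows "(LINT s:{t..1}|unit_measure. x s / s) = (LINT s:{t..1}|unit_measure. y s / s)"
  unfolding set_lebesgue_integral_def
proof (rule Bochner_Integration.integral_cong_AE)
  have [measurable]: "x \<in> borel_measurable unit_measure" "y \<in> borel_measurable unit_measure"
    using assms by (auto simp: L2_rel_def dest: square_integrable_measurable)
  show "(\<lambda>s. indicator {t..1} s *\<^sub>R (x s / s)) \<in> borel_measurable unit_measure"
    "(\<lambda>s. indicator {t..1} s *\<^sub>R (y s / s)) \<in> borel_measurable unit_measure"
    by measurable
qed (use assms in \<open>auto simp: L2_rel_def\<close>)

text \<open>Since sequences are indexed from \<open>0\<close>, the exponent \<open>j - 1\<close> of the moments becomes \<open>j\<close>,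
  and the weights \<open>1 / j\<close> of \<open>D\<close> become \<open>1 / (j + 1)\<close>.\<close>

lift_definition hausdorff_op :: "L2 \<Rightarrow> ell2" is
  "\<lambda>x j. LINT t|unit_measure. x t * t ^ j"
  by (simp add: moment_cong summable_moments L2_rel_def[THEN iffD1])

lemma hausdorff_op_nth: "square_integrable x \<Longrightarrow> ell2_nth (hausdorff_op (abs_L2 x)) j = (LINT t|unit_measure. x t * t ^ j)"
  by (simp add: hausdorff_op.rep_eq hausdorff_op.abs_eq L2_rel_def Abs_ell2_inverse summable_moments)

lift_definition cesaro_adjoint_op :: "L2 \<Rightarrow> L2" is
  "\<lambda>x t. LINT s:{t..1}|unit_measure. x s / s"
  by (auto simp: L2_rel_def[of "\<lambda>t. LINT s:{t..1}|unit_measure. _ s / s"] tail_integral_cong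
      intro!: square_integrable_tail_integral) (auto simp: L2_rel_def)

lift_definition diagonal_op :: "ell2 \<Rightarrow> ell2" is
  "\<lambda>y j. y j / (real j + 1)"
proof -
  fix y :: "nat \<Rightarrow> real" assume y: "summable (\<lambda>j. (y j)\<^sup>2)"
  show "summable (\<lambda>j. (y j / (real j + 1))\<^sup>2)"
  proof (rule summable_comparison_test'[OF y])
    show "norm ((y j / (real j + 1))\<^sup>2) \<le> (y j)\<^sup>2" for j
      by (simp add: power_divide divide_le_eq) (simp add: mult_le_cancel_left1 self_le_power)
  qed
qed

lemma norm_L2_eq: "square_integrable x \<Longrightarrow> norm (abs_L2 x) = sqrt (LINT t|unit_measure. (x t)\<^sup>2)"
  by (simp add: norm_L2_def inner_L2.abs_eq L2_rel_def power2_eq_square)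

lemma L2_cases:
  obtains x where "square_integrable x" "X = abs_L2 x"
  using Quotient_abs_rep[OF Quotient_L2, of X] Quotient_rep_reflp[OF Quotient_L2, of X]
  by (metis L2_rel_def)

lemma norm_ell2_eq: "norm y = sqrt (\<Sum>j. (ell2_nth y j)\<^sup>2)"
  by (simp add: norm_ell2_def inner_ell2.rep_eq power2_eq_square)

lemma summable_ell2: "summable (\<lambda>j. (ell2_nth y j)\<^sup>2)"
  using ell2_nth[of y] by simp

lemma bounded_linear_hausdorff_op: "bounded_linear hausdorff_op"
proof (rule bounded_linear_intro[where K = 2])
  show "hausdorff_op (x + y) = hausdorff_op x + hausdorff_op y" for x y
    by transfer (auto simp: L2_rel_def fun_eq_iff distrib_right integrable_L2_power)
  show "hausdorff_op (c *\<^sub>R x) = c *\<^sub>R hausdorff_op x" for c x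
    by transfer (auto simp: fun_eq_iff mult.assoc)
  show "norm (hausdorff_op X) \<le> norm X * 2" for X
  proof (cases X rule: L2_cases)
    case (1 x)
    have "(\<Sum>j. (ell2_nth (hausdorff_op X) j)\<^sup>2) \<le> 4 * (LINT t|unit_measure. (x t)\<^sup>2)"
      using moments_bound[OF 1(1)] summable_moments[OF 1(1)] 1
      by (intro suminf_le_const) (auto simp: hausdorff_op_nth)
    then have "norm (hausdorff_op X) \<le> sqrt (4 * (LINT t|unit_measure. (x t)\<^sup>2))"
      unfolding norm_ell2_eq by (rule real_sqrt_le_mono)
    then show ?thesis
      using 1 by (simp add: norm_L2_eq real_sqrt_mult)
  qed
qed

lemma bounded_linear_cesaro_adjoint_op: "bounded_linear cesaro_adjoint_op"
proof (rule bounded_linear_intro[where K = 2])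
  have int: "integrable unit_measure (\<lambda>s. indicator {t..1} s * (x s / s))"
    if "square_integrable x" "t \<in> {0<..<1}" for x t
    using that by (intro integrable_L2_tail) auto
  show "cesaro_adjoint_op (X + Y) = cesaro_adjoint_op X + cesaro_adjoint_op Y" for X Y
  proof transfer
    fix x y assume "L2_rel x x" "L2_rel y y"
    then have xy: "square_integrable x" "square_integrable y" by (auto simp: L2_rel_def)
    have "(LINT s:{t..1}|unit_measure. (x s + y s) / s) =
       (LINT s:{t..1}|unit_measure. x s / s) + (LINT s:{t..1}|unit_measure. y s / s)"
      if "t \<in> {0<..<1}" for t
      unfolding set_lebesgue_integral_def add_divide_distrib real_scaleR_def distrib_left
      by (intro Bochner_Integration.integral_add int xy that)
    then show "L2_rel (\<lambda>t. LINT s:{t..1}|unit_measure. (x s + y s) / s)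
      (\<lambda>t. (LINT s:{t..1}|unit_measure. x s / s) + (LINT s:{t..1}|unit_measure. y s / s))"
      unfolding L2_rel_def
      by (intro conjI square_integrable_tail_integral square_integrable_add xy AE_I2) auto
  qed
  show "cesaro_adjoint_op (c *\<^sub>R X) = c *\<^sub>R cesaro_adjoint_op X" for c X
  proof transfer
    fix c :: real and x assume "L2_rel x x"
    then have x: "square_integrable x" by (auto simp: L2_rel_def)
    have "(LINT s:{t..1}|unit_measure. (c * x s) / s) = c * (LINT s:{t..1}|unit_measure. x s / s)" for t
      by (simp flip: times_divide_eq_right)
    then show "L2_rel (\<lambda>t. LINT s:{t..1}|unit_measure. (c * x s) / s)
      (\<lambda>t. c * (LINT s:{t..1}|unit_measure. x s / s))"
      unfolding L2_rel_def
      by (intro conjI square_integrable_tail_integral square_integrable_cmult x AE_I2) auto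
  qed
  show "norm (cesaro_adjoint_op X) \<le> norm X * 2" for X
  proof (cases X rule: L2_cases)
    case (1 x)
    note sq = square_integrable_tail_integral[OF 1(1)]
    have "ennreal (LINT t|unit_measure. (LINT s:{t..1}|unit_measure. x s / s)\<^sup>2)
        \<le> ennreal (4 * (LINT t|unit_measure. (x t)\<^sup>2))"
      using tail_integral_bound[OF 1(1)] unfolding nn_integral_square[OF sq] .
    then have "(LINT t|unit_measure. (LINT s:{t..1}|unit_measure. x s / s)\<^sup>2)
        \<le> 4 * (LINT t|unit_measure. (x t)\<^sup>2)"
      by (subst (asm) ennreal_le_iff) auto
    moreover have "cesaro_adjoint_op X = abs_L2 (\<lambda>t. LINT s:{t..1}|unit_measure. x s / s)"
      using 1 by (simp add: cesaro_adjoint_op.abs_eq L2_rel_def)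
    ultimately show ?thesis
      using real_sqrt_le_mono[of _ "4 * (LINT t|unit_measure. (x t)\<^sup>2)"] 1 sq
      by (simp add: norm_L2_eq real_sqrt_mult mult.commute)
  qed
qed

lemma bounded_linear_diagonal_op: "bounded_linear diagonal_op"
proof (rule bounded_linear_intro[where K = 1])
  show "diagonal_op (x + y) = diagonal_op x + diagonal_op y" for x y
    by transfer (simp add: add_divide_distrib)
  show "diagonal_op (c *\<^sub>R x) = c *\<^sub>R diagonal_op x" for c x
    by transfer simp
  show "norm (diagonal_op y) \<le> norm y * 1" for y
    unfolding norm_ell2_eq mult_1_right
  proof (intro real_sqrt_le_mono suminf_le summable_ell2)
    show "(ell2_nth (diagonal_op y) j)\<^sup>2 \<le> (ell2_nth y j)\<^sup>2" for j
      by (simp add: diagonal_op.rep_eq power_divide divide_le_eq) (simp add: mult_le_cancel_left1 self_le_power)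
  qed
qed

lemma integral_power_head:
  assumes "0 < s" "s < 1"
  shows "(LINT t|unit_measure. indicator {0..s} t * t ^ j) = s ^ (j + 1) / (real j + 1)"
proof -
  have "(\<integral>\<^sup>+t. ennreal (indicator {0..s} t * t ^ j) \<partial>unit_measure)
      = (\<integral>\<^sup>+t. ennreal (t powr real j) * indicator {0..s} t \<partial>unit_measure)"
    by (rule nn_integral_cong) (auto simp: indicator_def powr_realpow)
  also have "\<dots> = ennreal (s ^ (j + 1) / (real j + 1))"
    using nn_integral_powr_head[OF assms, of "real j"] assms powr_realpow[of s "j + 1"]
    by (simp add: add.commute)
  finally show ?thesis
    using assms by (intro integral_eq_nn_integral[THEN trans]) (auto simp: indicator_def)
qed

lemma diagonal_hausdorff_eq: "diagonal_op \<circ> hausdorff_op = hausdorff_op \<circ> cesaro_adjoint_op"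
proof
  fix X
  let ?U = unit_measure
  show "(diagonal_op \<circ> hausdorff_op) X = (hausdorff_op \<circ> cesaro_adjoint_op) X"
  proof (cases X rule: L2_cases)
    case (1 x)
    have [measurable]: "x \<in> borel_measurable ?U"
      by (rule square_integrable_measurable[OF 1(1)])
    have C: "cesaro_adjoint_op X = abs_L2 (\<lambda>t. LINT s:{t..1}|?U. x s / s)"
      using 1 by (simp add: cesaro_adjoint_op.abs_eq L2_rel_def)
    have "(LINT t|?U. x t * t ^ j) / (real j + 1) = (LINT t|?U. (LINT s:{t..1}|?U. x s / s) * t ^ j)" for j
    proof -
      define f where "f t s = (if t \<le> s \<and> s \<le> 1 then t ^ j * (x s / s) else 0)" for t s
      have [measurable]: "fst \<in> borel_measurable (?U \<Otimes>\<^sub>M ?U)" "snd \<in> borel_measurable (?U \<Otimes>\<^sub>M ?U)"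
        by (auto intro: measurable_compose[OF measurable_fst id_measurable_unit]
            measurable_compose[OF measurable_snd id_measurable_unit])
      have f: "f t = (\<lambda>s. t ^ j * (indicator {t..1} s * (x s / s)))" for t
        by (auto simp: f_def indicator_def)
      have int: "integrable (?U \<Otimes>\<^sub>M ?U) (case_prod f)"
      proof (rule unit_pair.Fubini_integrable)
        show "case_prod f \<in> borel_measurable (?U \<Otimes>\<^sub>M ?U)"
          unfolding f_def split_beta' by measurable
        have "integrable ?U (\<lambda>t. (LINT s:{t..1}|?U. \<bar>x s\<bar> / s) * t ^ j)"
          by (intro integrable_L2_power square_integrable_tail_integral square_integrable_abs 1)
        also have "?this \<longleftrightarrow> integrable ?U (\<lambda>t. LINT s|?U. norm (case_prod f (t, s)))"
        proof (rule Bochner_Integration.integrable_cong)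
          fix t assume "t \<in> space ?U"
          then have t: "0 < t" by simp
          have "(LINT s|?U. norm (case_prod f (t, s))) = (LINT s|?U. t ^ j * (indicator {t..1} s * (\<bar>x s\<bar> / s)))"
            by (rule Bochner_Integration.integral_cong) (use t in \<open>auto simp: f abs_mult indicator_def\<close>)
          also have "\<dots> = t ^ j * (LINT s:{t..1}|?U. \<bar>x s\<bar> / s)"
            by (simp only: integral_mult_right_zero set_lebesgue_integral_def real_scaleR_def)
          finally show "(LINT s:{t..1}|?U. \<bar>x s\<bar> / s) * t ^ j = (LINT s|?U. norm (case_prod f (t, s)))"
            by (simp only: mult.commute[of _ "t ^ j"])
        qed simp
        finally show "integrable ?U (\<lambda>t. LINT s|?U. norm (case_prod f (t, s)))" .
        show "AE t in ?U. integrable ?U (\<lambda>s. case_prod f (t, s))"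
          by (rule AE_I2, unfold f prod.case) (intro integrable_mult_right integrable_L2_tail 1, simp)
      qed
      have "(LINT t|?U. x t * t ^ j) / (real j + 1) = (LINT s|?U. x s * s ^ j / (real j + 1))"
        by simp
      also have "\<dots> = (LINT s|?U. LINT t|?U. f t s)"
      proof (rule Bochner_Integration.integral_cong)
        fix s assume "s \<in> space ?U"
        then have s: "0 < s" "s < 1" by auto
        have "(LINT t|?U. f t s) = (LINT t|?U. (x s / s) * (indicator {0..s} t * t ^ j))"
          by (rule Bochner_Integration.integral_cong) (use s in \<open>auto simp: f_def indicator_def\<close>)
        also have "\<dots> = (x s / s) * (s ^ (j + 1) / (real j + 1))"
          by (simp only: integral_mult_right_zero integral_power_head[OF s])
        finally show "x s * s ^ j / (real j + 1) = (LINT t|?U. f t s)"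
          using s by simp
      qed simp
      also have "\<dots> = (LINT t|?U. LINT s|?U. f t s)"
        by (rule unit_pair.Fubini_integral[OF int])
      also have "\<dots> = (LINT t|?U. (LINT s:{t..1}|?U. x s / s) * t ^ j)"
      proof (rule Bochner_Integration.integral_cong)
        fix t
        have "(LINT s|?U. f t s) = t ^ j * (LINT s:{t..1}|?U. x s / s)"
          by (simp only: f integral_mult_right_zero set_lebesgue_integral_def real_scaleR_def)
        then show "(LINT s|?U. f t s) = (LINT s:{t..1}|?U. x s / s) * t ^ j"
          by (simp only: mult.commute)
      qed simp
      finally show ?thesis .
    qed
    then show ?thesis
      unfolding o_def C unfolding 1(2)
      by (simp add: 1 diagonal_op.rep_eq hausdorff_op_nth square_integrable_tail_integral
          fun_eq_iff flip: ell2_nth_inject)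
  qed
qed


definition ell2_box :: "real \<Rightarrow> ell2 set" where
  "ell2_box c = {y. \<forall>j. \<bar>ell2_nth y j\<bar> \<le> c / (real j + 1)}"

lemma summable_inverse_squares: "summable (\<lambda>j. (c / (real j + 1))\<^sup>2)"
proof -
  have "summable (\<lambda>n. 1 / real n ^ 2)"
    using inverse_power_summable[of 2, where 'a = real] by (simp add: inverse_eq_divide)
  then have "summable (\<lambda>j. c\<^sup>2 * (1 / real (Suc j) ^ 2))"
    by (subst (asm) summable_Suc_iff[symmetric]) (rule summable_mult)
  then show ?thesis by (simp add: power_divide add.commute)
qed

lemma compact_ell2_box: "compact (ell2_box c)"
proof -
  define S where "S j = {- (c / (real j + 1))..c / (real j + 1)}" for j :: nat
  define P where "P = PiE UNIV S"
  have bound: "\<bar>f j\<bar> \<le> c / (real j + 1)" if "f \<in> P" for f j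
    using that by (auto simp: P_def S_def PiE_UNIV_domain abs_le_iff minus_le_iff)
  have sq: "(f j)\<^sup>2 \<le> (c / (real j + 1))\<^sup>2" if "f \<in> P" for f j
    using power_mono[OF bound[OF that, of j] abs_ge_zero, of 2] by simp
  have sum: "summable (\<lambda>j. (f j)\<^sup>2)" if "f \<in> P" for f
    using sq[OF that] by (intro summable_comparison_test'[OF summable_inverse_squares[of c]]) auto
  have "compactin (product_topology (\<lambda>_. euclidean) UNIV) P"
    unfolding P_def by (subst compactin_PiE) (auto simp: S_def)
  then have "compact P"
    by (simp add: euclidean_product_topology)
  moreover have "continuous_on P Abs_ell2"
    unfolding continuous_on
  proof
    fix a assume a: "a \<in> P"
    have "((\<lambda>f. \<Sum>j. (f j - a j)\<^sup>2) \<longlongrightarrow> (\<Sum>j. (a j - a j)\<^sup>2)) (at a within P)"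
    proof (cases "at a within P = bot")
      case False
      have id: "((\<lambda>f. f) \<longlongrightarrow> a) (at a within P)" by (rule tendsto_ident_at)
      show ?thesis
      proof (rule tannerys_theorem[where M = "\<lambda>j. (2 * c / (real j + 1))\<^sup>2", THEN conjunct2, THEN conjunct2])
        show "((\<lambda>f. (f j - a j)\<^sup>2) \<longlongrightarrow> (a j - a j)\<^sup>2) (at a within P)" for j
          by (intro tendsto_intros tendsto_compose[OF _ id, of "\<lambda>f. f j", simplified])
            (use continuous_on_product_coordinates[of j] in \<open>auto simp: continuous_on_def tendsto_within_subset\<close>)
        have "norm ((f j - a j)\<^sup>2) \<le> (2 * c / (real j + 1))\<^sup>2" if "f \<in> P" for f j
        proof -
          have "\<bar>f j - a j\<bar> \<le> 2 * c / (real j + 1)"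
            using bound[OF that, of j] bound[OF a, of j] by simp
          then show ?thesis using power_mono[of "\<bar>f j - a j\<bar>" _ 2] by simp
        qed
        then have "\<forall>\<^sub>F f in (at a within P). \<forall>j. norm ((f j - a j)\<^sup>2) \<le> (2 * c / (real j + 1))\<^sup>2"
          by (auto simp: eventually_at_filter)
        then show "\<forall>\<^sub>F (j, f) in at_top \<times>\<^sub>F (at a within P). norm ((f j - a j)\<^sup>2) \<le> (2 * c / (real j + 1))\<^sup>2"
          unfolding eventually_prod_filter
            by (intro exI[of _ "\<lambda>_. True"]
                exI[of _ "\<lambda>f. \<forall>j. norm ((f j - a j)\<^sup>2) \<le> (2 * c / (real j + 1))\<^sup>2"]) auto
      qed (use False summable_inverse_squares in auto)
    qed auto
    then have "((\<lambda>f. sqrt (\<Sum>j. (f j - a j)\<^sup>2)) \<longlongrightarrow> 0) (at a within P)"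
      by (auto dest: tendsto_real_sqrt)
    moreover have "\<forall>\<^sub>F f in (at a within P). sqrt (\<Sum>j. (f j - a j)\<^sup>2) = dist (Abs_ell2 f) (Abs_ell2 a)"
    proof -
      have "sqrt (\<Sum>j. (f j - a j)\<^sup>2) = dist (Abs_ell2 f) (Abs_ell2 a)" if "f \<in> P" for f
        using a that by (simp add: dist_ell2_def norm_ell2_eq minus_ell2.rep_eq Abs_ell2_inverse sum)
      then show ?thesis by (auto simp: eventually_at_filter)
    qed
    ultimately have "((\<lambda>f. dist (Abs_ell2 f) (Abs_ell2 a)) \<longlongrightarrow> 0) (at a within P)"
      by (rule Lim_transform_eventually)
    then show "(Abs_ell2 \<longlongrightarrow> Abs_ell2 a) (at a within P)"
      by (subst tendsto_dist_iff)
  qed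
  ultimately have "compact (Abs_ell2 ` P)"
    by (rule compact_continuous_image[rotated])
  also have "Abs_ell2 ` P = ell2_box c"
  proof (intro equalityI subsetI)
    fix y assume "y \<in> ell2_box c"
    then have "ell2_nth y \<in> P"
      by (auto simp: ell2_box_def P_def S_def PiE_UNIV_domain abs_le_iff minus_le_iff)
    then show "y \<in> Abs_ell2 ` P"
      by (metis ell2_nth_inverse imageI)
  qed (auto simp: ell2_box_def bound sum Abs_ell2_inverse)
  finally show ?thesis .
qed

definition compact_operator :: "('a::real_normed_vector \<Rightarrow> 'b::real_normed_vector) \<Rightarrow> bool" where
  "compact_operator T \<longleftrightarrow> bounded_linear T \<and> compact (closure (T ` cball 0 1))"

lemma abs_ell2_nth_le_norm: "\<bar>ell2_nth y j\<bar> \<le> norm y"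
proof -
  have "(ell2_nth y j)\<^sup>2 \<le> (\<Sum>j. (ell2_nth y j)\<^sup>2)"
    using sum_le_suminf[OF summable_ell2, of "{j}"] by simp
  then show ?thesis
    unfolding norm_ell2_eq by (rule real_le_rsqrt[of "\<bar>_\<bar>", simplified])
qed

lemma compact_operator_diagonal_hausdorff: "compact_operator (diagonal_op \<circ> hausdorff_op)"
proof -
  obtain c where c: "\<And>x. norm (hausdorff_op x) \<le> norm x * c" "0 < c"
    using bounded_linear.pos_bounded[OF bounded_linear_hausdorff_op] by auto
  have "(diagonal_op \<circ> hausdorff_op) ` cball 0 1 \<subseteq> ell2_box c"
  proof
    fix y assume "y \<in> (diagonal_op \<circ> hausdorff_op) ` cball 0 1"
    then obtain x where x: "norm x \<le> 1" "y = diagonal_op (hausdorff_op x)" by auto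
    have "norm x * c \<le> 1 * c"
      by (rule mult_right_mono[OF x(1)]) (use c(2) in simp)
    then have "\<bar>ell2_nth (hausdorff_op x) j\<bar> \<le> c" for j
      using abs_ell2_nth_le_norm[of "hausdorff_op x" j] c(1)[of x] by linarith
    then show "y \<in> ell2_box c"
      by (simp add: ell2_box_def x diagonal_op.rep_eq divide_right_mono)
  qed
  then have "closure ((diagonal_op \<circ> hausdorff_op) ` cball 0 1) \<subseteq> ell2_box c"
    by (intro closure_minimal compact_imp_closed compact_ell2_box)
  then have "compact (closure ((diagonal_op \<circ> hausdorff_op) ` cball 0 1))"
    using compact_Int_closed[OF compact_ell2_box closed_closure] by (metis Int_absorb1)
  moreover have "bounded_linear (diagonal_op \<circ> hausdorff_op)"
    unfolding o_def
    by (rule bounded_linear_compose[OF bounded_linear_diagonal_op bounded_linear_hausdorff_op])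
  ultimately show ?thesis by (simp add: compact_operator_def)
qed

lemma compact_operator_hausdorff_cesaro: "compact_operator (hausdorff_op \<circ> cesaro_adjoint_op)"
  using compact_operator_diagonal_hausdorff by (simp add: diagonal_hausdorff_eq)


section \<open>Singular values\<close>

text \<open>The positive singular values of \<open>T\<close> are the square roots of the positive eigenvalues of
  \<open>T\<^sup>* T\<close>, and the multiplicity of a singular value is the dimension of the corresponding
  eigenspace.  The number \<open>singular_value T i\<close>, with \<open>i = 1, 2, \<dots>\<close>, is the \<open>i\<close>-th largest one,
  i.e. the largest \<open>s\<close> such that at least \<open>i\<close> singular values, counted with multiplicity, are
  \<open>\<ge> s\<close>; it is \<open>0\<close> if \<open>T\<close> has fewer than \<open>i\<close> positive singular values.  This is meant for
  compact \<open>T\<close> between Hilbert spaces: then \<open>adjoint T\<close> is the Hilbert space adjoint, the eigenspaces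
  and the sets of singular values summed over are finite(-dimensional), and the supremum is
  attained.\<close>

definition singular_values :: "('a::real_inner \<Rightarrow> 'b::real_inner) \<Rightarrow> real set" where
  "singular_values T = {s. 0 < s \<and> (\<exists>x. x \<noteq> 0 \<and> adjoint T (T x) = s\<^sup>2 *\<^sub>R x)}"

definition singular_multiplicity :: "('a::real_inner \<Rightarrow> 'b::real_inner) \<Rightarrow> real \<Rightarrow> nat" where
  "singular_multiplicity T s = dim {x. adjoint T (T x) = s\<^sup>2 *\<^sub>R x}"

definition singular_value :: "('a::real_inner \<Rightarrow> 'b::real_inner) \<Rightarrow> nat \<Rightarrow> real" where
  "singular_value T i = Sup (insert 0 {s \<in> singular_values T.
     i \<le> (\<Sum>t | t \<in> singular_values T \<and> s \<le> t. singular_multiplicity T t)})"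

end

theory Submission
  imports Defs
begin

text \<open>
  A subspace of dimension \<open>n\<close> on which \<open>\<parallel>T x\<parallel> \<ge> s \<parallel>x\<parallel>\<close> forces \<open>\<sigma>\<^sub>n(T) \<ge> s\<close>. We take the
  polynomials of degree less than \<open>n\<close>, with the shifted Legendre polynomials as orthonormal basis.
  The coordinates of \<open>x\<close> in this basis are linear combinations of the moments \<open>[H x]\<^sub>j\<close>, \<open>j \<le> n\<close>, with
  the coefficients of the Legendre polynomials as weights. Those are bounded by \<open>6\<^sup>n\<close>, and
  \<open>[H x]\<^sub>j = j [T x]\<^sub>j\<close> costs another factor \<open>n\<close>. So \<open>\<parallel>x\<parallel> \<le> 2 n\<^sup>2 6\<^sup>n \<parallel>T x\<parallel>\<close>, which is enough because
  \<open>6 < e\<^sup>2\<close>.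
\<close>

section \<open>Lower bounds for singular values\<close>

definition orthonormal :: "'a::real_inner set \<Rightarrow> bool" where
  "orthonormal B \<longleftrightarrow> pairwise orthogonal B \<and> (\<forall>b\<in>B. norm b = 1)"

lemma orthonormal_inner:
  "orthonormal B \<Longrightarrow> b \<in> B \<Longrightarrow> c \<in> B \<Longrightarrow> b \<bullet> c = (if b = c then 1 else 0)"
  by (auto simp: orthonormal_def pairwise_def orthogonal_def dot_square_norm)

lemma orthonormal_subset: "orthonormal B \<Longrightarrow> C \<subseteq> B \<Longrightarrow> orthonormal C"
  by (auto simp: orthonormal_def intro: pairwise_subset)

lemma orthonormal_independent: "orthonormal B \<Longrightarrow> independent B"
  by (rule pairwise_orthogonal_independent) (auto simp: orthonormal_def)

lemma orthonormal_insert: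
  "orthonormal B \<Longrightarrow> norm z = 1 \<Longrightarrow> (\<And>b. b \<in> B \<Longrightarrow> z \<bullet> b = 0) \<Longrightarrow> orthonormal (insert z B)"
  by (auto simp: orthonormal_def pairwise_insert orthogonal_def inner_commute)

lemma orthonormal_residual:
  assumes "orthonormal B" "finite B" "c \<in> B"
  shows "(x - (\<Sum>b\<in>B. (x \<bullet> b) *\<^sub>R b)) \<bullet> c = 0"
proof -
  have "(\<Sum>b\<in>B. (x \<bullet> b) * (b \<bullet> c)) = (\<Sum>b\<in>B. if b = c then x \<bullet> c else 0)"
    by (rule sum.cong) (auto simp: orthonormal_inner[OF assms(1) _ assms(3)])
  then show ?thesis
    using assms by (simp add: inner_diff_left inner_sum_left)
qed

text \<open>Parseval's identity for a finite orthonormal set. It reduces the estimate of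
  \<open>norm X\<close> by \<open>norm (T X)\<close> to an estimate of single coordinates.\<close>

lemma norm_sq_orthonormal_span:
  assumes "orthonormal B" "finite B" "x \<in> span B"
  shows "(norm x)\<^sup>2 = (\<Sum>b\<in>B. (x \<bullet> b)\<^sup>2)"
proof -
  have x: "(\<Sum>b\<in>B. (x \<bullet> b) *\<^sub>R b) = x"
    by (rule orthonormal_basis_expand) (use assms in \<open>auto simp: orthonormal_def\<close>)
  have "(norm x)\<^sup>2 = x \<bullet> (\<Sum>b\<in>B. (x \<bullet> b) *\<^sub>R b)"
    by (simp add: x dot_square_norm)
  then show ?thesis by (simp add: inner_sum_right power2_eq_square)
qed

text \<open>The projection onto \<open>span B\<close> cannot be injective on \<open>span V\<close>,
  since it would map \<open>V\<close> to more independent vectors than \<open>span B\<close> admits.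
  Any nonzero kernel vector in \<open>span V\<close> is orthogonal to \<open>B\<close>.\<close>

lemma exists_orthogonal_in_span:
  assumes "orthonormal B" "finite B" "independent V" "card B < card V"
  obtains x where "x \<in> span V" "x \<noteq> 0" "\<And>b. b \<in> B \<Longrightarrow> x \<bullet> b = 0"
proof -
  define P where "P x = (\<Sum>b\<in>B. (x \<bullet> b) *\<^sub>R b)" for x :: 'a
  have "linear P"
    by (rule linearI)
       (simp_all add: P_def inner_add_left scaleR_add_left sum.distrib scaleR_sum_right)
  have "\<not> inj_on P (span V)"
  proof
    assume inj: "inj_on P (span V)"
    then have "independent (P ` V)"
      by (rule linear_independent_injective_image[OF \<open>linear P\<close> assms(3)])
    moreover have "P ` V \<subseteq> span B"
      by (auto simp: P_def intro!: span_sum span_scale intro: span_base)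
    ultimately have "card (P ` V) \<le> card B"
      using independent_span_bound[OF assms(2)] by blast
    moreover have "card (P ` V) = card V"
      by (rule card_image) (rule inj_on_subset[OF inj span_superset])
    ultimately show False using assms(4) by simp
  qed
  then obtain x where x: "x \<in> span V" "x \<noteq> 0" "P x = 0"
    using linear_inj_on_iff_eq_0[OF \<open>linear P\<close> subspace_span] by blast
  have "x \<bullet> b = 0" if "b \<in> B" for b
    using orthonormal_residual[OF assms(1,2) that, of x] x(3) by (simp add: P_def)
  with x that show thesis by blast
qed

text \<open>For a maximizing sequence \<open>x\<^sub>n\<close> one has \<open>S T x\<^sub>n - M\<^sup>2 x\<^sub>n \<longlonglongrightarrow> 0\<close>. Hence \<open>x\<^sub>n\<close> converges as soon as
  \<open>T x\<^sub>n\<close> does, and neither completeness nor weak compactness is needed.\<close>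

lemma compact_operator_attains_norm:
  fixes T :: "'a::real_inner \<Rightarrow> 'b::real_inner" and S :: "'b \<Rightarrow> 'a"
  assumes T: "compact_operator T" and adj: "\<And>x y. T x \<bullet> y = x \<bullet> S y"
    and W: "subspace W" "closed W" "\<And>x. x \<in> W \<Longrightarrow> S (T x) \<in> W"
    and x0: "x0 \<in> W" "x0 \<noteq> 0" "s * norm x0 \<le> norm (T x0)" and s: "0 < s"
  obtains z M where "z \<in> W" "z \<noteq> 0" "s \<le> M" "S (T z) = M\<^sup>2 *\<^sub>R z"
proof -
  have bl: "bounded_linear T" and cpt: "compact (closure (T ` cball 0 1))"
    using T by (auto simp: compact_operator_def)
  interpret T: bounded_linear T by (rule bl)
  obtain K where K: "0 < K" "\<And>x. norm (T x) \<le> norm x * K"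
    using T.pos_bounded by blast
  \<comment> \<open>The adjoint identity turns the square of \<open>norm (S y)\<close> into the
    inner product of \<open>T (S y)\<close> and \<open>y\<close>, which is at most
    \<open>K * norm (S y) * norm y\<close>; so \<open>S\<close> inherits the bound \<open>K\<close>
    of \<open>T\<close>.\<close>
  have blS: "bounded_linear S"
  proof (rule bounded_linear_intro[where K = K])
    show "S (x + y) = S x + S y" for x y
      by (rule vector_eq_ldot[THEN iffD1]) (simp add: inner_add_right flip: adj)
    show "S (c *\<^sub>R x) = c *\<^sub>R S x" for c x
      by (rule vector_eq_ldot[THEN iffD1]) (simp flip: adj)
    show "norm (S y) \<le> norm y * K" for y
    proof -
      have "norm (S y) * norm (S y) = T (S y) \<bullet> y"
        by (simp add: adj dot_square_norm power2_eq_square)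
      also have "\<dots> \<le> norm (T (S y)) * norm y"
        by (rule norm_cauchy_schwarz)
      also have "\<dots> \<le> (norm (S y) * K) * norm y"
        by (intro mult_right_mono K) simp
      finally have "norm (S y) * norm (S y) \<le> norm (S y) * (norm y * K)"
        by (simp add: mult_ac)
      then show ?thesis
        using K(1) by (cases "norm (S y) = 0") (auto simp: mult_le_cancel_left)
    qed
  qed
  \<comment> \<open>\<open>M\<close> is the operator norm of \<open>T\<close> restricted to
    \<open>W\<close>.\<close>
  define R where "R = (\<lambda>x. norm (T x)) ` (W \<inter> cball 0 1)"
  define M where "M = Sup R"
  have bdd: "bdd_above R"
  proof (rule bdd_aboveI)
    fix r assume "r \<in> R"
    then obtain x where "norm x \<le> 1" "r = norm (T x)" by (auto simp: R_def)
    then show "r \<le> K"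
      using K(2)[of x] mult_right_mono[of "norm x" 1 K] K(1) by linarith
  qed
  have upper: "norm (T x) \<le> M * norm x" if "x \<in> W" for x
  proof (cases "x = 0")
    case False
    have "norm (T (x /\<^sub>R norm x)) \<le> M"
      unfolding M_def
      by (rule cSup_upper[OF _ bdd])
         (use that False in \<open>auto simp: R_def intro!: imageI subspace_scale[OF W(1)]\<close>)
    then show ?thesis
      using False by (simp add: T.scaleR divide_simps)
  qed (simp add: T.zero)
  have sM: "s \<le> M"
  proof -
    have "s * norm x0 \<le> M * norm x0" using upper[OF x0(1)] x0(3) by linarith
    then show ?thesis using x0(2) by simp
  qed
  have "R \<noteq> {}"
    using subspace_0[OF W(1)] by (auto simp: R_def)
  have "\<exists>x. x \<in> W \<and> norm x \<le> 1 \<and> M - 1 / (real n + 1) < norm (T x)" for n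
  proof -
    have "M - 1 / (real n + 1) < Sup R" by (simp add: M_def)
    then show ?thesis
      using less_cSup_iff[OF \<open>R \<noteq> {}\<close> bdd] by (auto simp: R_def)
  qed
  then obtain x where x: "\<And>n. x n \<in> W" "\<And>n. norm (x n) \<le> 1"
      "\<And>n. M - 1 / (real n + 1) < norm (T (x n))"
    by metis
  have xM: "norm (T (x n)) \<le> M" for n
    using upper[OF x(1), of n] mult_left_mono[OF x(2), of M n] sM s by linarith
  have lim_norm: "(\<lambda>n. norm (T (x n))) \<longlonglongrightarrow> M"
  proof (rule tendsto_sandwich[where h = "\<lambda>_. M"])
    have "(\<lambda>n. M - 1 / (real (Suc n))) \<longlonglongrightarrow> M - 0"
      by (intro tendsto_diff tendsto_const) (rule LIMSEQ_Suc[OF lim_1_over_n])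
    then show "(\<lambda>n. M - 1 / (real n + 1)) \<longlonglongrightarrow> M"
      by (simp add: add.commute)
  qed (use less_imp_le[OF x(3)] xM in \<open>auto intro!: always_eventually\<close>)
  have "T (x n) \<in> closure (T ` cball 0 1)" for n
    by (rule subsetD[OF closure_subset]) (use x(2) in auto)
  then obtain y r where r: "strict_mono r" and y: "(\<lambda>n. T (x (r n))) \<longlonglongrightarrow> y"
    using cpt unfolding compact_eq_seq_compact_metric by (auto elim!: seq_compactE simp: o_def)
  have Sy: "(\<lambda>n. S (T (x (r n)))) \<longlonglongrightarrow> S y"
    by (rule bounded_linear.tendsto[OF blS y])
  have diff: "(\<lambda>n. S (T (x n)) - M\<^sup>2 *\<^sub>R x n) \<longlonglongrightarrow> 0"
  proof -
    \<comment> \<open>Expand the square. The cross term is the square of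
      \<open>norm (T (x n))\<close> by the adjoint identity, and \<open>norm (S (T (x n)))\<close>
      is at most \<open>M * norm (T (x n))\<close> because \<open>S (T (x n))\<close> again lies in
      \<open>W\<close>.\<close>
    have bound: "(norm (S (T (x n)) - M\<^sup>2 *\<^sub>R x n))\<^sup>2 \<le> M ^ 4 - M\<^sup>2 * (norm (T (x n)))\<^sup>2" for n
    proof -
      let ?a = "S (T (x n))"
      have "norm ?a * norm ?a = T ?a \<bullet> T (x n)"
        by (simp add: adj dot_square_norm power2_eq_square)
      also have "\<dots> \<le> norm (T ?a) * norm (T (x n))"
        by (rule norm_cauchy_schwarz)
      also have "\<dots> \<le> (M * norm ?a) * norm (T (x n))"
        by (intro mult_right_mono upper W(3) x(1)) simp
      finally have "norm ?a * norm ?a \<le> norm ?a * (M * norm (T (x n)))"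
        by (simp add: mult_ac)
      then have "norm ?a \<le> M * norm (T (x n))"
        using sM s by (cases "norm ?a = 0") (auto simp: mult_le_cancel_left)
      then have a: "(norm ?a)\<^sup>2 \<le> M\<^sup>2 * (norm (T (x n)))\<^sup>2"
        using power_mono[of "norm ?a" "M * norm (T (x n))" 2] by (simp add: power_mult_distrib)
      have x1: "M ^ 4 * (norm (x n))\<^sup>2 \<le> M ^ 4 * 1"
        by (intro mult_left_mono power_le_one x(2)) auto
      have M4: "M ^ 4 = M\<^sup>2 * M\<^sup>2" by (simp flip: power_add)
      have "(norm (?a - M\<^sup>2 *\<^sub>R x n))\<^sup>2 = (norm ?a)\<^sup>2 - 2 * (M\<^sup>2 * (?a \<bullet> x n)) + M ^ 4 * (norm (x n))\<^sup>2"
        unfolding M4 power2_norm_eq_inner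
        by (simp add: inner_diff_left inner_diff_right inner_commute algebra_simps)
      also have "?a \<bullet> x n = (norm (T (x n)))\<^sup>2"
        using adj[of "x n" "T (x n)"] by (simp add: power2_norm_eq_inner inner_commute)
      finally show ?thesis using a x1 by simp
    qed
    have "(\<lambda>n. M ^ 4 - M\<^sup>2 * (norm (T (x n)))\<^sup>2) \<longlonglongrightarrow> M ^ 4 - M\<^sup>2 * M\<^sup>2"
      by (intro tendsto_intros lim_norm)
    then have "(\<lambda>n. M ^ 4 - M\<^sup>2 * (norm (T (x n)))\<^sup>2) \<longlonglongrightarrow> 0"
      by (simp add: power4_eq_xxxx power2_eq_square)
    then have "(\<lambda>n. (norm (S (T (x n)) - M\<^sup>2 *\<^sub>R x n))\<^sup>2) \<longlonglongrightarrow> 0"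
      by (rule tendsto_sandwich[OF _ _ tendsto_const, rotated 2]) (auto intro!: always_eventually bound)
    then have "(\<lambda>n. sqrt ((norm (S (T (x n)) - M\<^sup>2 *\<^sub>R x n))\<^sup>2)) \<longlonglongrightarrow> sqrt 0"
      by (rule tendsto_real_sqrt)
    then show ?thesis by (simp add: tendsto_norm_zero_iff)
  qed
  \<comment> \<open>\<open>S (T (x (r n)))\<close> tends to \<open>S y\<close> and differs from
    \<open>x (r n)\<close> scaled by the square of \<open>M\<close> by a null sequence, so this is
    the only possible limit of \<open>x (r n)\<close>.\<close>
  define z where "z = S y /\<^sub>R M\<^sup>2"
  have M0: "M > 0" using s sM by simp
  have "(\<lambda>n. (S (T (x (r n))) - (S (T (x (r n))) - M\<^sup>2 *\<^sub>R x (r n))) /\<^sub>R M\<^sup>2) \<longlonglongrightarrow> (S y - 0) /\<^sub>R M\<^sup>2"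
    by (intro tendsto_intros Sy LIMSEQ_subseq_LIMSEQ[OF diff r, unfolded o_def])
  then have xz: "(\<lambda>n. x (r n)) \<longlonglongrightarrow> z"
    using M0 by (simp add: z_def)
  have "T z = y"
    by (rule LIMSEQ_unique[OF T.tendsto[OF xz] y])
  then have "S (T z) = M\<^sup>2 *\<^sub>R z"
    using M0 by (simp add: z_def)
  moreover have "z \<in> W"
    by (rule closed_sequentially[OF W(2) _ xz]) (rule x(1))
  \<comment> \<open>A maximizing sequence keeps its images away from 0, which excludes
    \<open>z = 0\<close>.\<close>
  moreover have "norm y = M"
    by (rule LIMSEQ_unique[OF tendsto_norm[OF y] LIMSEQ_subseq_LIMSEQ[OF lim_norm r, unfolded o_def]])
  then have "z \<noteq> 0"
    using \<open>T z = y\<close> M0 by (auto simp: T.zero)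
  ultimately show thesis using that sM by blast
qed

text \<open>The images of orthonormal eigenvectors are orthogonal with norms at least \<open>s\<close>, and a compact
  set contains only boundedly many points with mutual distances at least \<open>s\<close>.\<close>

lemma card_singular_vectors_bounded:
  fixes T :: "'a::real_inner \<Rightarrow> 'b::real_inner" and S :: "'b \<Rightarrow> 'a"
  assumes T: "compact_operator T" and adj: "\<And>x y. T x \<bullet> y = x \<bullet> S y" and s: "0 < s"
  obtains N where "\<And>B. orthonormal B \<Longrightarrow> (\<And>b. b \<in> B \<Longrightarrow> \<exists>t\<ge>s. S (T b) = t\<^sup>2 *\<^sub>R b) \<Longrightarrow>
    finite B \<and> card B \<le> N"
proof -
  have "compact (closure (T ` cball 0 1))"
    using T by (simp add: compact_operator_def)
  \<comment> \<open>Two points in a common ball of radius \<open>s/2\<close> are less than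
    \<open>s\<close> apart, so each ball can hold at most one image \<open>T b\<close>.\<close>
  then obtain F where F: "finite F" "closure (T ` cball 0 1) \<subseteq> (\<Union>c\<in>F. ball c (s/2))"
    using compact_eq_totally_bounded[of "closure (T ` cball 0 1)"] s
    by (metis half_gt_zero)
  have "finite B \<and> card B \<le> card F"
    if B: "orthonormal B" and eig: "\<And>b. b \<in> B \<Longrightarrow> \<exists>t\<ge>s. S (T b) = t\<^sup>2 *\<^sub>R b" for B
  proof -
    have "\<exists>c\<in>F. dist c (T b) < s/2" if "b \<in> B" for b
    proof -
      have "T b \<in> closure (T ` cball 0 1)"
        by (rule subsetD[OF closure_subset]) (use that B in \<open>auto simp: orthonormal_def\<close>)
      then show ?thesis using F(2) by (auto simp: subset_iff)
    qed
    then obtain h where h: "\<And>b. b \<in> B \<Longrightarrow> h b \<in> F" "\<And>b. b \<in> B \<Longrightarrow> dist (h b) (T b) < s/2"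
      by metis
    have "inj_on h B"
    proof (rule inj_onI, rule ccontr)
      fix b c assume bc: "b \<in> B" "c \<in> B" "h b = h c" "b \<noteq> c"
      obtain t where t: "t \<ge> s" "S (T b) = t\<^sup>2 *\<^sub>R b" using eig[OF bc(1)] by blast
      have "(norm (T b))\<^sup>2 = t\<^sup>2"
        using adj[of b "T b"] t(2) B bc(1)
        by (simp add: power2_norm_eq_inner orthonormal_inner)
      moreover have "T c \<bullet> T b = 0"
        using adj[of c "T b"] t(2) bc orthonormal_inner[OF B bc(2,1)] by simp
      then have "(norm (T b - T c))\<^sup>2 = (norm (T b))\<^sup>2 + (norm (T c))\<^sup>2"
        by (simp add: power2_norm_eq_inner inner_diff_left inner_diff_right inner_commute)
      ultimately have "t\<^sup>2 \<le> (norm (T b - T c))\<^sup>2" by simp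
      then have "s \<le> dist (T b) (T c)"
        using power2_le_imp_le[of t "norm (T b - T c)"] t(1) by (simp add: dist_norm)
      moreover have "dist (T b) (T c) < s"
        using h(2)[OF bc(1)] h(2)[OF bc(2)] bc(3) by (metis dist_commute dist_triangle_half_r)
      ultimately show False by simp
    qed
    then show ?thesis
      using h(1) F(1) by (metis card_inj_on_le finite_imageD finite_subset image_subsetI)
  qed
  then show thesis by (rule that)
qed

text \<open>The min-max principle. Take a largest orthonormal set \<open>B\<close> of eigenvectors
  of \<open>S T\<close> with eigenvalues at least the square of \<open>s\<close>. If
  \<open>B\<close> had fewer than \<open>n\<close> elements, \<open>span V\<close> would contain a
  nonzero vector orthogonal to \<open>B\<close>; on the orthogonal complement of \<open>B\<close>
  the operator would then attain its norm, which is at least \<open>s\<close>, at a further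
  eigenvector. So \<open>B\<close> has at least \<open>n\<close> elements, and these count the
  singular values from \<open>s\<close> upwards with multiplicity.\<close>

lemma singular_value_ge:
  fixes T :: "'a::real_inner \<Rightarrow> 'b::real_inner" and S :: "'b \<Rightarrow> 'a"
  assumes T: "compact_operator T" and adj: "\<And>x y. T x \<bullet> y = x \<bullet> S y"
    and V: "independent V" "card V = n" "n \<ge> 1"
    and s: "0 < s" and lower: "\<And>x. x \<in> span V \<Longrightarrow> s * norm x \<le> norm (T x)"
  shows "s \<le> singular_value T n"
proof -
  \<comment> \<open>\<open>adjoint\<close> is a choice among the maps satisfying the adjoint
    identity, so it is known only once such a map is exhibited.\<close>
  have S: "adjoint T = S"
    by (rule adjoint_unique) (use adj in blast)
  interpret T: bounded_linear T using T by (simp add: compact_operator_def)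
  have S_add: "S (x + y) = S x + S y" for x y
    by (rule vector_eq_ldot[THEN iffD1]) (simp add: inner_add_right flip: adj)
  have S_scale: "S (c *\<^sub>R x) = c *\<^sub>R S x" for c x
    by (rule vector_eq_ldot[THEN iffD1]) (simp flip: adj)
  have symm: "S (T x) \<bullet> y = x \<bullet> S (T y)" for x y
    by (metis adj inner_commute)
  have norm_eig: "norm (T x) = t * norm x" if "S (T x) = t\<^sup>2 *\<^sub>R x" "0 \<le> t" for x t
  proof -
    have "(norm (T x))\<^sup>2 = (t * norm x)\<^sup>2"
      using adj[of x "T x"] that(1) by (simp add: power2_norm_eq_inner power_mult_distrib)
    then show ?thesis using that(2) by (simp add: power2_eq_iff_nonneg)
  qed
  define \<E> where "\<E> t = {x. S (T x) = t\<^sup>2 *\<^sub>R x}" for t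
  have sub\<E>: "subspace (\<E> t)" for t
    by (rule subspaceI)
       (auto simp: \<E>_def T.zero T.add T.scaleR S_add S_scale scaleR_add_right S_scale[of 0 0, simplified])
  define admissible where
    "admissible B \<longleftrightarrow> orthonormal B \<and> (\<forall>b\<in>B. \<exists>t\<ge>s. b \<in> \<E> t)" for B
  obtain N where N: "\<And>B. admissible B \<Longrightarrow> finite B \<and> card B \<le> N"
    using card_singular_vectors_bounded[OF T adj s] unfolding admissible_def \<E>_def mem_Collect_eq by metis
  have "admissible {}" by (simp add: admissible_def orthonormal_def)
  \<comment> \<open>All admissible sets have at most \<open>N\<close> elements, so one of greatest
    cardinality exists.\<close>
  then have "\<exists>B. admissible B \<and> (\<forall>C. admissible C \<longrightarrow> card C \<le> card B)"
    by (rule Lattices_Big.ex_has_greatest_nat[where b = "Suc N"]) (use N in \<open>auto simp: less_Suc_eq_le\<close>)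
  then obtain B where B: "admissible B" and max: "\<And>C. admissible C \<Longrightarrow> card C \<le> card B"
    by blast
  have finB: "finite B" and onB: "orthonormal B"
    using N[OF B] B by (auto simp: admissible_def)
  have eigB: "b \<in> \<E> (norm (T b))" "s \<le> norm (T b)" "0 < norm (T b)" if "b \<in> B" for b
  proof -
    have "\<exists>t\<ge>s. b \<in> \<E> t" using B that by (simp add: admissible_def)
    then obtain t where t: "t \<ge> s" "b \<in> \<E> t" by blast
    have "norm (T b) = t"
      using norm_eig[of b t] t s onB that by (simp add: \<E>_def orthonormal_def)
    then show "b \<in> \<E> (norm (T b))" "s \<le> norm (T b)" "0 < norm (T b)" using t s by auto
  qed
  have maximal: "z = 0" if z: "z \<in> \<E> t" "t \<ge> s" "\<And>b. b \<in> B \<Longrightarrow> z \<bullet> b = 0" for z t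
  proof (rule ccontr)
    assume "z \<noteq> 0"
    define u where "u = z /\<^sub>R norm z"
    have "norm u = 1" "\<And>b. b \<in> B \<Longrightarrow> u \<bullet> b = 0" "u \<in> \<E> t"
      using \<open>z \<noteq> 0\<close> z by (auto simp: u_def subspace_scale[OF sub\<E>])
    then have "admissible (insert u B)"
      using B z(2) orthonormal_insert[of B u] by (auto simp: admissible_def)
    moreover have "u \<notin> B"
      using \<open>norm u = 1\<close> \<open>\<And>b. b \<in> B \<Longrightarrow> u \<bullet> b = 0\<close> by (metis inner_eq_zero_iff norm_zero zero_neq_one)
    ultimately show False
      using max[of "insert u B"] finB by simp
  qed

  have "n \<le> card B"
  proof (rule ccontr)
    assume "\<not> n \<le> card B"
    then obtain x0 where x0: "x0 \<in> span V" "x0 \<noteq> 0" "\<And>b. b \<in> B \<Longrightarrow> x0 \<bullet> b = 0"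
      using exists_orthogonal_in_span[OF onB finB V(1)] V(2) by auto
    define W where "W = {x. \<forall>b\<in>B. x \<bullet> b = 0}"
    have "subspace W"
      by (rule subspaceI) (auto simp: W_def inner_add_left)
    moreover have "closed W"
    proof -
      have "W = (\<Inter>b\<in>B. {x. x \<bullet> b = 0})" by (auto simp: W_def)
      then show ?thesis
        by (auto intro!: closed_INT closed_Collect_eq continuous_intros)
    qed
    moreover have "S (T x) \<in> W" if "x \<in> W" for x
      using that eigB(1) by (auto simp: W_def symm \<E>_def)
    moreover have "x0 \<in> W" using x0(3) by (simp add: W_def)
    ultimately obtain z M where "z \<in> W" "z \<noteq> 0" "s \<le> M" "S (T z) = M\<^sup>2 *\<^sub>R z"
      using compact_operator_attains_norm[OF T adj _ _ _ _ x0(2) lower[OF x0(1)] s] by blast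
    then show False
      using maximal[of z M] by (auto simp: W_def \<E>_def)
  qed

  define fiber where "fiber t = {b\<in>B. norm (T b) = t}" for t
  \<comment> \<open>The residual of an eigenvector after projection to \<open>fiber t\<close> stays
    in the eigenspace. It is orthogonal to \<open>fiber t\<close> by construction and to the rest of
    \<open>B\<close> because eigenvectors of a symmetric operator for distinct eigenvalues are
    orthogonal. Maximality makes it 0.\<close>
  have fiber_dim: "card (fiber t) = dim (\<E> t)" and fiber_span: "\<E> t \<subseteq> span (fiber t)" if "t \<ge> s" for t
  proof -
    have fib\<E>: "fiber t \<subseteq> \<E> t" using eigB(1) by (auto simp: fiber_def)
    have on: "orthonormal (fiber t)" "finite (fiber t)"
      using onB finB by (auto simp: fiber_def intro: orthonormal_subset)
    show "\<E> t \<subseteq> span (fiber t)"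
    proof
      fix x assume x: "x \<in> \<E> t"
      define p where "p = (\<Sum>b\<in>fiber t. (x \<bullet> b) *\<^sub>R b)"
      have "p \<in> \<E> t"
        unfolding p_def by (intro subspace_sum sub\<E> subspace_scale) (use fib\<E> in auto)
      then have d: "x - p \<in> \<E> t" by (rule subspace_diff[OF sub\<E> x])
      have "(x - p) \<bullet> b = 0" if b: "b \<in> B" for b
      proof (cases "norm (T b) = t")
        case True
        then show ?thesis
          using orthonormal_residual[OF on] b by (simp add: p_def fiber_def)
      next
        case False
        have "t\<^sup>2 * ((x - p) \<bullet> b) = (norm (T b))\<^sup>2 * ((x - p) \<bullet> b)"
          using symm[of "x - p" b] d eigB(1)[OF b] by (simp add: \<E>_def)
        moreover have "t\<^sup>2 \<noteq> (norm (T b))\<^sup>2"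
          using False \<open>t \<ge> s\<close> s by (simp add: power2_eq_iff_nonneg)
        ultimately show ?thesis by simp
      qed
      then have "x - p = 0" by (rule maximal[OF d \<open>t \<ge> s\<close>])
      moreover have "p \<in> span (fiber t)"
        unfolding p_def by (intro span_sum span_scale span_base)
      ultimately show "x \<in> span (fiber t)" by simp
    qed
    then show "card (fiber t) = dim (\<E> t)"
      using dim_unique[OF fib\<E> _ orthonormal_independent[OF on(1)] refl] by simp
  qed
  define \<Sigma> where "\<Sigma> = {t. t \<in> singular_values T \<and> s \<le> t}"
  have \<Sigma>: "\<Sigma> = (\<lambda>b. norm (T b)) ` B"
  proof (intro equalityI subsetI)
    fix t assume "t \<in> \<Sigma>"
    then obtain x where x: "x \<noteq> 0" "x \<in> \<E> t" "s \<le> t"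
      by (auto simp: \<Sigma>_def singular_values_def \<E>_def S)
    then have "fiber t \<noteq> {}" using fiber_span[of t] by auto
    then show "t \<in> (\<lambda>b. norm (T b)) ` B" by (auto simp: fiber_def)
  next
    fix t assume "t \<in> (\<lambda>b. norm (T b)) ` B"
    then obtain b where b: "b \<in> B" "t = norm (T b)" by auto
    have "norm b = 1" using b onB by (simp add: orthonormal_def)
    then have "b \<noteq> 0" by auto
    then show "t \<in> \<Sigma>"
      using eigB[OF b(1)] b(2) by (auto simp: \<Sigma>_def singular_values_def \<E>_def S intro!: exI[of _ b])
  qed
  have "card B = (\<Sum>t\<in>\<Sigma>. card (fiber t))"
    using sum.image_gen[OF finB, of "\<lambda>_. 1::nat" "\<lambda>b. norm (T b)"] by (simp add: \<Sigma> fiber_def)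
  also have "\<dots> = (\<Sum>t\<in>\<Sigma>. singular_multiplicity T t)"
    by (rule sum.cong) (simp_all add: fiber_dim \<Sigma>_def singular_multiplicity_def S \<E>_def)
  finally have card: "n \<le> (\<Sum>t\<in>\<Sigma>. singular_multiplicity T t)"
    using \<open>n \<le> card B\<close> by simp
  have fin\<Sigma>: "finite \<Sigma>" and ne: "\<Sigma> \<noteq> {}"
    using finB \<open>n \<le> card B\<close> V(3) by (auto simp: \<Sigma>)
  \<comment> \<open>The supremum in \<open>singular_value\<close> ranges over singular values only,
    and \<open>s\<close> need not be one. The least singular value that is at least \<open>s\<close>
    has the same singular values above it.\<close>
  define m where "m = Min \<Sigma>"
  have m: "m \<in> \<Sigma>" "\<And>t. t \<in> \<Sigma> \<Longrightarrow> m \<le> t"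
    using Min_in[OF fin\<Sigma> ne] Min_le[OF fin\<Sigma>] by (auto simp: m_def)
  then have "\<Sigma> = {t. t \<in> singular_values T \<and> m \<le> t}" by (auto simp: \<Sigma>_def)
  with card m(1) have mem: "m \<in> {u \<in> singular_values T.
      n \<le> (\<Sum>t | t \<in> singular_values T \<and> u \<le> t. singular_multiplicity T t)}"
    by (simp add: \<Sigma>_def)
  \<comment> \<open>The supremum dominates \<open>m\<close> only if the set is bounded above; the
    operator bound of \<open>T\<close> provides this.\<close>
  obtain K where K: "\<And>x. norm (T x) \<le> norm x * K" "0 < K" using T.pos_bounded by blast
  have "t \<le> K" if "t \<in> singular_values T" for t
  proof -
    obtain x where x: "x \<noteq> 0" "0 < t" "S (T x) = t\<^sup>2 *\<^sub>R x"
      using \<open>t \<in> singular_values T\<close> by (auto simp: singular_values_def S)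
    then have "t * norm x \<le> norm x * K" using norm_eig[of x t] K(1)[of x] by simp
    then show ?thesis using x(1) by (simp add: mult.commute)
  qed
  then have "bdd_above (insert 0 {u \<in> singular_values T.
      n \<le> (\<Sum>t | t \<in> singular_values T \<and> u \<le> t. singular_multiplicity T t)})"
    unfolding bdd_above_insert by (intro bdd_aboveI[of _ K]) blast
  then have "m \<le> singular_value T n"
    unfolding singular_value_def by (rule cSup_upper[rotated]) (use mem in blast)
  then show ?thesis using m(1) by (simp add: \<Sigma>_def)
qed


section \<open>The adjoint operator\<close>

text \<open>On (0,1) the terms are dominated by the summable numbers \<open>\<bar>c j\<bar>\<close>.
  Hence the power series is bounded, and summation and integration may be exchanged.\<close>

lemma sums_inner_L2_power_series:
  assumes x: "square_integrable x" and c: "summable (\<lambda>j. \<bar>c j\<bar>)"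
  shows "square_integrable (\<lambda>t. \<Sum>j. c j * t ^ j)"
    and "(\<lambda>j. c j * (LINT t|unit_measure. x t * t ^ j)) sums
      (LINT t|unit_measure. x t * (\<Sum>j. c j * t ^ j))"
proof -
  let ?U = unit_measure
  have term_le: "\<bar>c j * t ^ j\<bar> \<le> \<bar>c j\<bar>" if "t \<in> {0<..<1}" for t j
    using that by (simp add: abs_mult mult_left_le power_le_one)
  have sum: "summable (\<lambda>j. \<bar>c j * t ^ j\<bar>)" if "t \<in> {0<..<1}" for t
    by (rule summable_comparison_test'[OF c]) (use term_le[OF that] in simp)
  show "square_integrable (\<lambda>t. \<Sum>j. c j * t ^ j)"
  proof (rule square_integrable_bounded)
    fix t :: real assume t: "t \<in> {0<..<1}"
    have "\<bar>\<Sum>j. c j * t ^ j\<bar> \<le> (\<Sum>j. \<bar>c j * t ^ j\<bar>)"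
      by (rule summable_rabs[OF sum[OF t]])
    also have "\<dots> \<le> (\<Sum>j. \<bar>c j\<bar>)"
      by (rule suminf_le[OF term_le[OF t] sum[OF t] c])
    finally show "\<bar>\<Sum>j. c j * t ^ j\<bar> \<le> (\<Sum>j. \<bar>c j\<bar>)" .
  qed measurable
  define f where "f j t = c j * (x t * t ^ j)" for j t
  have int: "integrable ?U (f j)" for j
    unfolding f_def by (intro integrable_mult_right integrable_L2_power x)
  have xabs: "integrable ?U (\<lambda>t. \<bar>x t\<bar>)"
    using integrable_L2_power[OF x, of 0] by simp
  have ae: "AE t in ?U. summable (\<lambda>j. norm (f j t))"
  proof (rule AE_I2)
    fix t assume "t \<in> space ?U"
    then have "summable (\<lambda>j. \<bar>x t\<bar> * \<bar>c j * t ^ j\<bar>)"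
      by (intro summable_mult sum) simp
    then show "summable (\<lambda>j. norm (f j t))"
      by (simp add: f_def abs_mult mult_ac)
  qed
  have summ: "summable (\<lambda>j. LINT t|?U. norm (f j t))"
  proof (rule summable_comparison_test')
    show "summable (\<lambda>j. \<bar>c j\<bar> * (LINT t|?U. \<bar>x t\<bar>))" by (rule summable_mult2[OF c])
    fix j
    have "(LINT t|?U. norm (f j t)) \<le> (LINT t|?U. \<bar>c j\<bar> * \<bar>x t\<bar>)"
    proof (rule integral_mono)
      fix t assume "t \<in> space ?U"
      then show "norm (f j t) \<le> \<bar>c j\<bar> * \<bar>x t\<bar>"
        using mult_right_mono[OF term_le[of t j] abs_ge_zero[of "x t"]] by (simp add: f_def abs_mult mult_ac)
    qed (use int xabs in auto)
    then show "norm (LINT t|?U. norm (f j t)) \<le> \<bar>c j\<bar> * (LINT t|?U. \<bar>x t\<bar>)"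
      by simp
  qed
  have "(\<lambda>j. LINT t|?U. f j t) sums (LINT t|?U. (\<Sum>j. f j t))"
    by (rule sums_integral[OF int ae summ])
  moreover have "(LINT t|?U. (\<Sum>j. f j t)) = (LINT t|?U. x t * (\<Sum>j. c j * t ^ j))"
  proof (rule Bochner_Integration.integral_cong)
    fix t assume "t \<in> space ?U"
    then have "summable (\<lambda>j. c j * t ^ j)"
      using summable_rabs_cancel[OF sum] by simp
    then show "(\<Sum>j. f j t) = x t * (\<Sum>j. c j * t ^ j)"
      by (simp add: f_def mult.left_commute flip: suminf_mult)
  qed simp
  ultimately show "(\<lambda>j. c j * (LINT t|?U. x t * t ^ j)) sums (LINT t|?U. x t * (\<Sum>j. c j * t ^ j))"
    by (simp add: f_def)
qed

text \<open>A product of the two square summable sequences \<open>y\<close> and 1/(j+1). This makes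
  the power series of the adjoint converge absolutely up to \<open>t = 1\<close>.\<close>

lemma summable_diagonal_op: "summable (\<lambda>j. \<bar>ell2_nth (diagonal_op y) j\<bar>)"
proof -
  have "summable (\<lambda>j. \<bar>ell2_nth y j\<bar> * (1 / (real j + 1)))"
    by (rule summable_mult_square) (use summable_ell2[of y] summable_inverse_squares[of 1] in auto)
  then show ?thesis by (simp add: diagonal_op.rep_eq)
qed

text \<open>The adjoint is written down explicitly, as the power series
  \<open>\<Sum>j. y\<^sub>j t\<^sup>j / (j + 1)\<close>: the Riesz representation theorem would need completeness of \<open>L2\<close>.\<close>

lemma diagonal_hausdorff_adjoint_exists:
  "\<exists>S. \<forall>X y. (diagonal_op \<circ> hausdorff_op) X \<bullet> y = X \<bullet> S y"
proof (intro exI allI)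
  fix X y
  show "(diagonal_op \<circ> hausdorff_op) X \<bullet> y =
      X \<bullet> abs_L2 (\<lambda>t. \<Sum>j. ell2_nth (diagonal_op y) j * t ^ j)"
  proof (cases X rule: L2_cases)
    case (1 x)
    note p = sums_inner_L2_power_series[OF 1(1) summable_diagonal_op[of y]]
    have "(diagonal_op \<circ> hausdorff_op) X \<bullet> y =
        (\<Sum>j. ell2_nth (diagonal_op y) j * (LINT t|unit_measure. x t * t ^ j))"
      by (simp add: inner_ell2.rep_eq diagonal_op.rep_eq 1(2) hausdorff_op_nth[OF 1(1)] mult.commute)
    also have "\<dots> = (LINT t|unit_measure. x t * (\<Sum>j. ell2_nth (diagonal_op y) j * t ^ j))"
      by (rule sums_unique[OF p(2), symmetric])
    also have "\<dots> = X \<bullet> abs_L2 (\<lambda>t. \<Sum>j. ell2_nth (diagonal_op y) j * t ^ j)"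
      using 1 p(1) by (simp add: inner_L2.abs_eq L2_rel_def)
    finally show ?thesis .
  qed
qed


section \<open>Shifted Legendre polynomials\<close>

lemma square_integrable_poly: "square_integrable (poly p)"
proof (rule square_integrable_bounded)
  show "poly p \<in> borel_measurable unit_measure"
    by (simp add: poly_altdef[abs_def])
  fix t :: real assume t: "t \<in> {0<..<1}"
  have "\<bar>poly p t\<bar> \<le> (\<Sum>i\<le>Polynomial.degree p. \<bar>coeff p i * t ^ i\<bar>)"
    unfolding poly_altdef by (rule sum_abs)
  also have "\<dots> \<le> (\<Sum>i\<le>Polynomial.degree p. \<bar>coeff p i\<bar>)"
    using t by (intro sum_mono) (simp add: abs_mult mult_left_le power_le_one)
  finally show "\<bar>poly p t\<bar> \<le> (\<Sum>i\<le>Polynomial.degree p. \<bar>coeff p i\<bar>)" .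
qed

definition poly_L2 :: "real poly \<Rightarrow> L2" where
  "poly_L2 p = abs_L2 (poly p)"

definition poly_integral :: "real poly \<Rightarrow> real" where
  "poly_integral p = (LINT t|unit_measure. poly p t)"

lemma integrable_poly: "integrable unit_measure (poly p)"
  using integrable_L2_power[OF square_integrable_poly, of p 0] by simp

text \<open>Passes to the gauge integral on the closed interval, where the fundamental theorem of
  calculus and the Beta integral are stated.\<close>

lemma poly_integral_eq: "poly_integral p = integral {0..1} (poly p)"
  unfolding poly_integral_def
  by (simp add: lebesgue_integral_eq_integral integrable_poly integral_open_interval_real)

lemma inner_poly_L2: "poly_L2 p \<bullet> poly_L2 q = poly_integral (p * q)"
  by (simp add: poly_L2_def poly_integral_def inner_L2.abs_eq L2_rel_def square_integrable_poly)

lemma poly_integral_pderiv: "poly_integral (pderiv p) = poly p 1 - poly p 0"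
proof -
  have "(poly (pderiv p) has_integral (poly p 1 - poly p 0)) {0..1}"
    by (rule fundamental_theorem_of_calculus)
       (simp_all add: has_field_derivative_at_within[OF poly_DERIV]
         flip: has_real_derivative_iff_has_vector_derivative)
  then show ?thesis
    by (simp add: poly_integral_eq integral_unique)
qed

lemma poly_integral_add: "poly_integral (p + q) = poly_integral p + poly_integral q"
  by (simp add: poly_integral_def integrable_poly)

lemma poly_integral_smult: "poly_integral (smult c p) = c * poly_integral p"
  by (simp add: poly_integral_def)

lemma poly_integral_by_parts:
  "poly_integral (pderiv p * q) = poly (p * q) 1 - poly (p * q) 0 - poly_integral (p * pderiv q)"
  using poly_integral_pderiv[of "p * q"]
  by (simp add: pderiv_mult poly_integral_add mult.commute[of q])

section \<open>Rodrigues' formula, orthogonality and coefficients\<close>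

lemma power_dvd_higher_pderiv:
  fixes u :: "'a::idom poly"
  shows "m \<le> k \<Longrightarrow> u ^ (k - m) dvd (pderiv ^^ m) (u ^ k)"
proof (induction m)
  case (Suc m)
  define n where "n = k - Suc m"
  have n: "k - m = Suc n" using Suc.prems by (simp add: n_def)
  obtain r where r: "(pderiv ^^ m) (u ^ k) = u ^ Suc n * r"
    using Suc.IH Suc.prems unfolding n by (meson Suc_leD dvdE)
  \<comment> \<open>By the product rule one differentiation costs at most one factor
    \<open>u\<close>. For \<open>u = bump\<close> this gives zeros at 0 and 1 for all derivatives of
    order below \<open>k\<close>.\<close>
  have "(pderiv ^^ Suc m) (u ^ k) = u ^ Suc n * pderiv r + r * (smult (of_nat (Suc n)) (u ^ n) * pderiv u)"
    unfolding funpow.simps o_def r pderiv_mult pderiv_power_Suc ..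
  also have "\<dots> = u ^ n * (u * pderiv r + smult (of_nat (Suc n)) (r * pderiv u))"
    by (simp only: power_Suc distrib_left mult_smult_left mult_smult_right mult_ac)
  finally show ?case unfolding n_def by (metis dvd_triv_left)
qed simp

definition bump :: "real poly" where
  "bump = [:0, 1, -1:]"

lemma poly_bump [simp]: "poly bump t = t * (1 - t)"
  by (simp add: bump_def algebra_simps)

text \<open>Rodrigues' formula for the shifted Legendre polynomials, up to sign.\<close>

definition legendre :: "nat \<Rightarrow> real poly" where
  "legendre k = smult (1 / fact k) ((pderiv ^^ k) (bump ^ k))"

text \<open>Integration by parts \<open>m\<close> times. Each boundary term contains a derivative of
  \<open>bump ^ k\<close> of order below \<open>k\<close>, which vanishes at both endpoints.\<close>

lemma poly_integral_higher_pderiv_bump: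
  "m \<le> k \<Longrightarrow> poly_integral ((pderiv ^^ k) (bump ^ k) * q) =
    (-1) ^ m * poly_integral ((pderiv ^^ (k - m)) (bump ^ k) * (pderiv ^^ m) q)"
proof (induction m)
  case (Suc m)
  define d where "d = k - Suc m"
  have d: "k - m = Suc d" "d \<le> k" "k - d \<noteq> 0" using Suc.prems by (auto simp: d_def)
  obtain r where r: "(pderiv ^^ d) (bump ^ k) = bump ^ (k - d) * r"
    using power_dvd_higher_pderiv[OF d(2), of bump] by (rule dvdE)
  have boundary: "poly ((pderiv ^^ d) (bump ^ k)) 0 = 0" "poly ((pderiv ^^ d) (bump ^ k)) 1 = 0"
    unfolding r poly_mult poly_power using d(3) by simp_all
  have "poly_integral ((pderiv ^^ k) (bump ^ k) * q) =
      (-1) ^ m * poly_integral ((pderiv ^^ Suc d) (bump ^ k) * (pderiv ^^ m) q)"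
    using Suc.IH Suc.prems unfolding d(1) by simp
  also have "poly_integral ((pderiv ^^ Suc d) (bump ^ k) * (pderiv ^^ m) q) =
      - poly_integral ((pderiv ^^ d) (bump ^ k) * (pderiv ^^ Suc m) q)"
    unfolding funpow.simps o_def poly_integral_by_parts poly_mult boundary by simp
  finally show ?case
    unfolding d_def by simp
qed simp

lemma coeff_one_minus_power: "coeff ([:1, -1:] ^ k :: real poly) j = (-1) ^ j * real (k choose j)"
proof (induction k arbitrary: j)
  case 0
  then show ?case by (cases j) auto
next
  case (Suc k)
  then show ?case by (cases j) (simp_all add: algebra_simps)
qed

text \<open>The \<open>k\<close>-th derivative moves coefficient \<open>j + k\<close> of
  \<open>bump ^ k\<close> to position \<open>j\<close> with factor (j+k)!/j!; division by k! leaves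
  a binomial coefficient. The degree, the top derivative and the size estimate are all read off from
  this formula.\<close>

lemma coeff_legendre:
  "coeff (legendre k) j = (-1) ^ j * real ((j + k) choose k) * real (k choose j)"
proof -
  have bump: "bump = [:0, 1:] * [:1, -1:]" by (simp add: bump_def)
  have "bump ^ k = monom 1 k * [:1, -1:] ^ k"
    unfolding bump power_mult_distrib monom_altdef smult_1_left ..
  then have "coeff (bump ^ k) (j + k) = (-1) ^ j * real (k choose j)"
    by (simp add: coeff_monom_mult coeff_one_minus_power)
  moreover have "pochhammer (real (Suc j)) k = fact k * real ((j + k) choose k)"
    by (simp add: binomial_gbinomial gbinomial_pochhammer' add.commute)
  ultimately show ?thesis
    by (simp add: legendre_def coeff_higher_pderiv)
qed

lemma higher_pderiv_legendre:
  "(pderiv ^^ m) (legendre m) = [:fact m * (-1) ^ m * real ((2 * m) choose m):]"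
  "j < m \<Longrightarrow> (pderiv ^^ m) (legendre j) = 0"
proof -
  show "(pderiv ^^ m) (legendre m) = [:fact m * (-1) ^ m * real ((2 * m) choose m):]"
  proof (rule poly_eqI)
    fix n
    show "coeff ((pderiv ^^ m) (legendre m)) n = coeff [:fact m * (-1) ^ m * real ((2 * m) choose m):] n"
      by (cases n) (simp_all add: coeff_higher_pderiv coeff_legendre mult_2 flip: pochhammer_fact)
  qed
  show "(pderiv ^^ m) (legendre j) = 0" if "j < m"
    by (rule poly_eqI) (use that in \<open>simp add: coeff_higher_pderiv coeff_legendre\<close>)
qed

lemma poly_integral_bump_power: "poly_integral (bump ^ k) = (fact k)\<^sup>2 / fact (2 * k + 1)"
proof -
  \<comment> \<open>The endpoints are removed because \<open>0 powr 0 = 0\<close> while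
    \<open>0 ^ 0 = 1\<close>, so for \<open>k = 0\<close> the integrands differ there.\<close>
  have "integral {0..1} (poly (bump ^ k)) = integral {0<..<1} (poly (bump ^ k))"
    by (rule integral_open_interval_real)
  also have "\<dots> = integral {0<..<1} (\<lambda>t. t powr (real (Suc k) - 1) * (1 - t) powr (real (Suc k) - 1))"
  proof (rule integral_cong)
    fix t :: real assume t: "t \<in> {0<..<1}"
    have "poly (bump ^ k) t = (t * (1 - t)) ^ k"
      by (simp add: poly_power)
    also have "\<dots> = t powr (real (Suc k) - 1) * (1 - t) powr (real (Suc k) - 1)"
      using t by (simp add: powr_realpow power_mult_distrib)
    finally show "poly (bump ^ k) t = t powr (real (Suc k) - 1) * (1 - t) powr (real (Suc k) - 1)" .
  qed
  also have "\<dots> = Beta (real (Suc k)) (real (Suc k))"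
    using has_integral_Beta_real[of "real (Suc k)" "real (Suc k)"]
    unfolding has_integral_Icc_iff_Ioo by (intro integral_unique) simp
  also have "\<dots> = (fact k)\<^sup>2 / fact (2 * k + 1)"
  proof -
    have "real (Suc k) + real (Suc k) = of_nat (2 * k + 1) + 1" by simp
    then show ?thesis
      using Gamma_fact[of k, where 'a = real] Gamma_fact[of "2 * k + 1", where 'a = real]
      by (simp only: Beta_def) (simp add: power2_eq_square add.commute)
  qed
  finally show ?thesis by (simp add: poly_integral_eq)
qed

text \<open>Moving all \<open>k\<close> derivatives to the other factor annihilates a Legendre
  polynomial of smaller index. For equal indices it leaves a constant times the Beta integral of
  \<open>bump ^ k\<close>.\<close>

lemma inner_legendre:
  "poly_L2 (legendre k) \<bullet> poly_L2 (legendre j) = (if j = k then 1 / (2 * real k + 1) else 0)"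
proof -
  have parts: "poly_integral (legendre k * q) =
      (-1) ^ k / fact k * poly_integral (bump ^ k * (pderiv ^^ k) q)" for k q
    using poly_integral_higher_pderiv_bump[of k k q]
    by (simp add: legendre_def poly_integral_smult)
  have less: "poly_integral (legendre k * legendre j) = 0" if "j < k" for j k
    using that poly_integral_smult[of 0 0] by (simp add: parts higher_pderiv_legendre)
  have "poly_integral (legendre k * legendre k) = 1 / (2 * real k + 1)"
  proof -
    have "poly_integral (legendre k * legendre k) =
        real ((2 * k) choose k) * (fact k)\<^sup>2 / fact (2 * k + 1)"
      by (simp add: parts higher_pderiv_legendre poly_integral_smult poly_integral_bump_power)
    also have "real ((2 * k) choose k) = fact (2 * k) / (fact k)\<^sup>2"
      by (simp add: binomial_fact power2_eq_square)
    also have "fact (2 * k + 1) = (2 * real k + 1) * fact (2 * k)"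
      by (simp add: algebra_simps)
    also have "fact (2 * k) / (fact k)\<^sup>2 * (fact k)\<^sup>2 / ((2 * real k + 1) * fact (2 * k)) = 1 / (2 * real k + 1)"
      by simp
    finally show ?thesis .
  qed
  then show ?thesis
    using less[of j k] less[of k j] by (cases j k rule: linorder_cases) (auto simp: inner_poly_L2 mult.commute)
qed

text \<open>The first binomial coefficient is at most 2^(j+k), so by the binomial theorem for
  (2+1)^k the absolute values sum to at most 2^k 3^k = 6^k. The Euclidean norm is at most this
  sum.\<close>

lemma legendre_coeffs_bound: "(\<Sum>j\<le>k. (coeff (legendre k) j)\<^sup>2) \<le> 36 ^ k"
proof -
  have "(\<Sum>j\<le>k. \<bar>coeff (legendre k) j\<bar>) \<le> (\<Sum>j\<le>k. 2 ^ k * (real (k choose j) * 2 ^ j * 1 ^ (k - j)))"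
  proof (rule sum_mono)
    fix j
    have "((j + k) choose k) \<le> (\<Sum>i\<le>j + k. (j + k) choose i)"
      by (rule member_le_sum) auto
    then have "((j + k) choose k) \<le> 2 ^ (j + k)"
      by (simp only: choose_row_sum)
    then have "real ((j + k) choose k) \<le> 2 ^ (j + k)"
      by (simp only: of_nat_le_numeral_power_cancel_iff)
    then have "real ((j + k) choose k) * real (k choose j) \<le> 2 ^ (j + k) * real (k choose j)"
      by (rule mult_right_mono) simp
    then show "\<bar>coeff (legendre k) j\<bar> \<le> 2 ^ k * (real (k choose j) * 2 ^ j * 1 ^ (k - j))"
      by (simp add: coeff_legendre abs_mult power_add mult_ac)
  qed
  also have "\<dots> = 2 ^ k * (2 + 1) ^ k"
    by (simp only: binomial_ring sum_distrib_left)
  also have "\<dots> = 6 ^ k" by (simp flip: power_mult_distrib)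
  finally have "L2_set (coeff (legendre k)) {..k} \<le> 6 ^ k"
    using L2_set_le_sum_abs[of "coeff (legendre k)" "{..k}"] by linarith
  then have "(L2_set (coeff (legendre k)) {..k})\<^sup>2 \<le> (6 ^ k)\<^sup>2"
    by (rule power_mono) (rule L2_set_nonneg)
  also have "((6::real) ^ k)\<^sup>2 = 36 ^ k"
    by (simp add: power2_eq_square flip: power_mult_distrib)
  finally show ?thesis
    by (simp add: L2_set_def sum_nonneg)
qed


section \<open>The lower bound\<close>

lemma inner_poly_L2_moments:
  assumes "Polynomial.degree p \<le> d"
  shows "X \<bullet> poly_L2 p = (\<Sum>j\<le>d. coeff p j * ell2_nth (hausdorff_op X) j)"
proof (cases X rule: L2_cases)
  case (1 x)
  have p: "poly p t = (\<Sum>j\<le>d. coeff p j * t ^ j)" for t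
    unfolding poly_altdef using assms
    by (intro sum.mono_neutral_left) (auto simp: coeff_eq_0)
  have "X \<bullet> poly_L2 p = (LINT t|unit_measure. x t * poly p t)"
    using 1 by (simp add: poly_L2_def inner_L2.abs_eq L2_rel_def square_integrable_poly)
  also have "\<dots> = (LINT t|unit_measure. (\<Sum>j\<le>d. coeff p j * (x t * t ^ j)))"
    by (simp add: p sum_distrib_left mult_ac)
  also have "\<dots> = (\<Sum>j\<le>d. coeff p j * (LINT t|unit_measure. x t * t ^ j))"
    by (subst Bochner_Integration.integral_sum) (auto simp: integrable_L2_power[OF 1(1)])
  finally show ?thesis
    by (simp add: 1 hausdorff_op_nth)
qed

lemma degree_legendre: "Polynomial.degree (legendre k) \<le> k"
  by (rule degree_le) (simp add: coeff_legendre)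

text \<open>Inverts the diagonal operator on the first \<open>n\<close> entries: with indices from 0
  its inverse weights are j+1, at most \<open>n\<close> for \<open>j < n\<close>.\<close>

lemma sum_moments_le:
  "(\<Sum>j<n. (ell2_nth (hausdorff_op X) j)\<^sup>2) \<le> (real n)\<^sup>2 * (norm ((diagonal_op \<circ> hausdorff_op) X))\<^sup>2"
proof -
  define y where "y = (diagonal_op \<circ> hausdorff_op) X"
  have "(\<Sum>j<n. (ell2_nth (hausdorff_op X) j)\<^sup>2) \<le> (\<Sum>j<n. (real n)\<^sup>2 * (ell2_nth y j)\<^sup>2)"
  proof (rule sum_mono)
    fix j assume j: "j \<in> {..<n}"
    have "ell2_nth (hausdorff_op X) j = (real j + 1) * ell2_nth y j"
      by (simp add: y_def diagonal_op.rep_eq)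
    then have "(ell2_nth (hausdorff_op X) j)\<^sup>2 = (real j + 1)\<^sup>2 * (ell2_nth y j)\<^sup>2"
      by (simp add: power_mult_distrib)
    also have "\<dots> \<le> (real n)\<^sup>2 * (ell2_nth y j)\<^sup>2"
      using j by (intro mult_right_mono power_mono) auto
    finally show "(ell2_nth (hausdorff_op X) j)\<^sup>2 \<le> (real n)\<^sup>2 * (ell2_nth y j)\<^sup>2" .
  qed
  also have "\<dots> = (real n)\<^sup>2 * (\<Sum>j<n. (ell2_nth y j)\<^sup>2)"
    by (simp add: sum_distrib_left)
  also have "\<dots> \<le> (real n)\<^sup>2 * (\<Sum>j. (ell2_nth y j)\<^sup>2)"
    by (intro mult_left_mono sum_le_suminf summable_ell2) auto
  also have "(\<Sum>j. (ell2_nth y j)\<^sup>2) = (norm y)\<^sup>2"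
    by (simp add: norm_ell2_eq suminf_nonneg summable_ell2)
  finally show ?thesis by (simp add: y_def)
qed

lemma singular_value_diagonal_hausdorff_ge:
  assumes "n \<ge> 1"
  shows "1 / (2 * (real n)\<^sup>2 * 6 ^ n) \<le> singular_value (diagonal_op \<circ> hausdorff_op) n"
proof -
  let ?T = "diagonal_op \<circ> hausdorff_op"
  obtain S where S: "\<And>X y. ?T X \<bullet> y = X \<bullet> S y"
    using diagonal_hausdorff_adjoint_exists by blast
  \<comment> \<open>The factor normalizes, since the squared norm of the Legendre polynomial is
    1/(2k+1).\<close>
  define e where "e k = sqrt (2 * real k + 1) *\<^sub>R poly_L2 (legendre k)" for k
  have ee: "e k \<bullet> e j = (if j = k then 1 else 0)" for j k
    by (simp add: e_def inner_legendre flip: real_sqrt_mult)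
  have inj: "inj_on e {..<n}"
    by (rule inj_onI) (metis ee zero_neq_one)
  have on: "orthonormal (e ` {..<n})"
    by (auto simp: orthonormal_def pairwise_def orthogonal_def ee norm_eq_1)
  have lower: "1 / (2 * (real n)\<^sup>2 * 6 ^ n) * norm X \<le> norm (?T X)" if X: "X \<in> span (e ` {..<n})" for X
  proof -
    \<comment> \<open>The three factors come from the normalization (2k+1 is at most 2n), from the
      Legendre coefficients via Cauchy-Schwarz, and from inverting the diagonal operator.\<close>
    have coord: "(X \<bullet> e k)\<^sup>2 \<le> 2 * real n * 36 ^ n * ((real n)\<^sup>2 * (norm (?T X))\<^sup>2)" if k: "k < n" for k
    proof -
      let ?m = "ell2_nth (hausdorff_op X)"
      have "(X \<bullet> e k)\<^sup>2 = (2 * real k + 1) * (\<Sum>j\<le>k. coeff (legendre k) j * ?m j)\<^sup>2"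
        by (simp add: e_def inner_poly_L2_moments[OF degree_legendre] power_mult_distrib)
      also have "\<dots> \<le> (2 * real k + 1) * ((\<Sum>j\<le>k. (coeff (legendre k) j)\<^sup>2) * (\<Sum>j\<le>k. (?m j)\<^sup>2))"
        by (intro mult_left_mono Cauchy_Schwarz_ineq_sum) auto
      also have "\<dots> \<le> (2 * real n) * (36 ^ n * ((real n)\<^sup>2 * (norm (?T X))\<^sup>2))"
      proof (intro mult_mono)
        have "(36::real) ^ k \<le> 36 ^ n" using k by (intro power_increasing) auto
        then show "(\<Sum>j\<le>k. (coeff (legendre k) j)\<^sup>2) \<le> 36 ^ n"
          using legendre_coeffs_bound[of k] by linarith
        have "(\<Sum>j\<le>k. (?m j)\<^sup>2) \<le> (\<Sum>j<n. (?m j)\<^sup>2)"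
          using k by (intro sum_mono2) auto
        then show "(\<Sum>j\<le>k. (?m j)\<^sup>2) \<le> (real n)\<^sup>2 * (norm (?T X))\<^sup>2"
          using sum_moments_le[of X n] by linarith
      qed (use k in \<open>auto intro!: sum_nonneg mult_nonneg_nonneg\<close>)
      finally show ?thesis by (simp only: mult.assoc)
    qed
    have "(norm X)\<^sup>2 = (\<Sum>k<n. (X \<bullet> e k)\<^sup>2)"
      using norm_sq_orthonormal_span[OF on _ X] by (simp add: sum.reindex[OF inj])
    also have "\<dots> \<le> (\<Sum>k<n. 2 * real n * 36 ^ n * ((real n)\<^sup>2 * (norm (?T X))\<^sup>2))"
      by (intro sum_mono coord) simp
    also have "\<dots> = 2 * ((real n)\<^sup>2 * 6 ^ n * norm (?T X))\<^sup>2"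
    proof -
      have "(36::real) ^ n = (6 ^ n)\<^sup>2" by (simp add: power2_eq_square flip: power_mult_distrib)
      then show ?thesis by (simp add: power_mult_distrib power2_eq_square)
    qed
    \<comment> \<open>The constant sqrt 2 that would remain after taking roots is rounded up to
      2.\<close>
    also have "\<dots> \<le> (2 * (real n)\<^sup>2 * 6 ^ n * norm (?T X))\<^sup>2"
      by (simp add: power_mult_distrib)
    finally have "norm X \<le> 2 * (real n)\<^sup>2 * 6 ^ n * norm (?T X)"
      by (rule power2_le_imp_le) simp
    then show ?thesis
      using assms by (simp add: divide_le_eq mult_ac)
  qed
  show ?thesis
    by (rule singular_value_ge[OF compact_operator_diagonal_hausdorff S orthonormal_independent[OF on] _ assms _ lower])
       (use assms inj in \<open>auto simp: card_image\<close>)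
qed

text \<open>The square of \<open>exp 1\<close> is at least (5/2)^2 = 25/4 = 6 (1 + 1/24). By
  Bernoulli's inequality the surplus (1 + 1/24)^n exceeds n/24 and absorbs the factor
  \<open>n\<close>.\<close>

lemma nat_mult_power_6_le_exp: "real n * 6 ^ n \<le> 24 * exp (2 * real n)"
proof -
  have "5/2 \<le> exp (1::real)"
    using exp_lower_Taylor_quadratic[of 1] by simp
  then have "(5/2)\<^sup>2 \<le> (exp (1::real))\<^sup>2"
    by (rule power_mono) simp
  also have "\<dots> = exp 2"
    by (simp flip: exp_double)
  finally have "(25/4) ^ n \<le> exp (2::real) ^ n"
    by (intro power_mono) (auto simp: power2_eq_square)
  have "real n * 6 ^ n \<le> 24 * ((1 + real n * (1/24)) * 6 ^ n)"
    by (simp add: algebra_simps)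
  also have "\<dots> \<le> 24 * ((1 + 1/24) ^ n * 6 ^ n)"
    by (intro mult_left_mono mult_right_mono Bernoulli_inequality) auto
  also have "\<dots> = 24 * (25/4) ^ n"
    by (simp flip: power_mult_distrib)
  also have "\<dots> \<le> 24 * exp (2 * real n)"
    using \<open>(25/4) ^ n \<le> exp 2 ^ n\<close> by (simp add: mult.commute[of 2] exp_of_nat_mult)
  finally show ?thesis .
qed

theorem theorem2:
  fixes T :: "L2 \<Rightarrow> ell2"
  assumes "T = hausdorff_op \<circ> cesaro_adjoint_op"
    and "T = diagonal_op \<circ> hausdorff_op"
  shows "\<exists>c\<^sub>0 :: real. c\<^sub>0 > 0 \<and>
    (\<forall>i :: nat. i \<ge> 1 \<longrightarrow> c\<^sub>0 / real i * exp (- 2 * real i) \<le> singular_value T i)"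
proof (intro exI[of _ "1/48"] conjI allI impI)
  fix i :: nat assume i: "i \<ge> 1"
  \<comment> \<open>The witness is 1/(2*24), with 2 from the singular value bound and 24 from the
    comparison with the exponential. That comparison absorbs one of the two factors
    \<open>real i\<close>.\<close>
  have "1/48 / real i * exp (- 2 * real i) = 1 / (2 * real i * (24 * exp (2 * real i)))"
    by (simp add: exp_minus field_simps)
  also have "\<dots> \<le> 1 / (2 * real i * (real i * 6 ^ i))"
    using i by (intro divide_left_mono mult_left_mono nat_mult_power_6_le_exp) auto
  also have "\<dots> = 1 / (2 * (real i)\<^sup>2 * 6 ^ i)"
    by (simp add: power2_eq_square)
  also have "\<dots> \<le> singular_value T i"
    unfolding assms(2) by (rule singular_value_diagonal_hausdorff_ge[OF i])
  finally show "1/48 / real i * exp (- 2 * real i) \<le> singular_value T i" .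
qed simp

end
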